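(* Let $d,n\ge1$ be integers. Let $\mathcal{A}\subseteq\mathrm{End}(\mathbb{C}^d)$ be a von Neumann algebra and let $G_{\mathcal{A}}$ be its gauge group. In the $n$-copy estimation scenario with single-copy prior $p$, parameters $\vec{\mathfrak{s}}=(\mathfrak{s}^{(1)},\dots,\mathfrak{s}^{(l)})$ and channel $\mathcal{E}$ (described in the context), assume that: 1. the prior $p$ and the vector of parameters $\vec{\mathfrak{s}}$ have the gauge group $G_{\mathcal{A}}$ as a symmetry; 2. the channel $\mathcal{E}$ is the identity channel; 3. the prior $p$ has support only on the pure states. Then for any given measurement with POVM $M:\sigma(\Omega)\to\mathrm{End}((\mathbb{C}^d)^{\otimes n})$, there is another measurement with POVM $M':\sigma(\Omega)\to\mathrm{End}((\mathbb{C}^d)^{\otimes n})$ whose image is entirely confined to $\mathcal{A}^{\otimes n}$, such that $$q_{M}(B|\vec S\in\vec\Delta)=q_{M'}(B|\vec S\in\vec\Delta)$$ for all $B\in\sigma(\Omega)$ and all $l$-dimensional intervals $\vec\Delta\subseteq\mathbb{R}^l$ which are assigned nonzero probability.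
   Context: A von Neumann algebra $\mathcal{A}\subseteq\mathrm{End}(\mathbb{C}^d)$ is a complex subalgebra containing the identity and closed under adjoint; its gauge group $G_{\mathcal{A}}$ is the group of all unitaries in $\mathrm{U}(d)$ commuting with every element of $\mathcal{A}$. Scenario: $d\rho$ is a fixed reference (Borel) measure on the set of density operators in $\mathrm{End}(\mathbb{C}^d)$, invariant under $\rho\mapsto V\rho V^\dagger$ for all $V\in\mathrm{U}(d)$. A state $\rho$ is chosen randomly according to a probability density $p$ relative to $d\rho$ (the single-copy prior), and $\rho^{\otimes n}$ is sent through a quantum channel (completely positive trace-preserving map) $\mathcal{E}$ on $\mathrm{End}((\mathbb{C}^d)^{\otimes n})$, then measured. $\mathrm{supp}(p)$ is the set of states to which $p$ assigns nonzero density. The parameters are (measurable) functions $\mathfrak{s}^{(i)}:\mathrm{supp}(p)\to\mathbb{R}$, $\vec{\mathfrak{s}}=(\mathfrak{s}^{(1)},\dots,\mathfrak{s}^{(l)})$, and $\vec S=\vec{\mathfrak{s}}(\rho)$ is the induced random vector. $p$ has a subgroup $H\subseteq\mathrm{U}(d)$ as a symmetry if $p(V\rho V^\dagger)=p(\rho)$ for all $V\in H$ and all $\rho$. $\vec{\mathfrak{s}}$ has $H$ as a symmetry if $\vec{\mathfrak{s}}(V\rho V^\dagger)=\vec{\mathfrak{s}}(\rho)$ for all $V\in H$ and all $\rho\in\mathrm{supp}(p)$. A POVM with outcome space a measurable space $(\Omega,\sigma(\Omega))$ is a countably additive map $M$ from $\sigma(\Omega)$ to positive operators with $M(\Omega)=\mathbb{I}^{\otimes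 n}$. Set $q_M(B|\rho)=\mathrm{tr}(M(B)\mathcal{E}(\rho^{\otimes n}))$, $\Pr(\vec S\in\vec\Delta)=\int_{\vec{\mathfrak{s}}(\rho)\in\vec\Delta}d\rho\,p(\rho)$ and $$q_M(B|\vec S\in\vec\Delta)=\frac{1}{\Pr(\vec S\in\vec\Delta)}\int_{\vec{\mathfrak{s}}(\rho)\in\vec\Delta}d\rho\,p(\rho)\,q_M(B|\rho).$$ *)

theory Defs
  imports "HOL-Analysis.Analysis"
begin

text \<open>
  Operators on the n-fold tensor power of \<open>\<complex>\<^sup>d\<close> are square matrices indexed by the finite function
  type \<open>'n \<Rightarrow> 'd\<close>, with \<open>CARD('n) = n\<close> tensor factors and \<open>CARD('d) = d\<close>: the standard basis of the
  tensor power consists of the tensors \<open>e (i k\<^sub>1) \<otimes> \<dots> \<otimes> e (i k\<^sub>n)\<close> for \<open>i :: 'n \<Rightarrow> 'd\<close>.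
\<close>

definition cinner :: "complex^'i \<Rightarrow> complex^'i \<Rightarrow> complex" where
  "cinner v w = (\<Sum>i\<in>UNIV. cnj (v $ i) * w $ i)"

definition dagger :: "complex^'i^'i \<Rightarrow> complex^'i^'i" where
  "dagger A = (\<chi> i j. cnj (A $ j $ i))"

definition cscale :: "complex \<Rightarrow> complex^'i^'i \<Rightarrow> complex^'i^'i" where
  "cscale c A = (\<chi> i j. c * A $ i $ j)"

interpretation cmat: vector_space cscale
  by unfold_locales (simp_all add: cscale_def vec_eq_iff algebra_simps)

definition unitary :: "complex^'i^'i \<Rightarrow> bool" where
  "unitary V \<longleftrightarrow> dagger V ** V = mat 1 \<and> V ** dagger V = mat 1"

text \<open>Positivity on a complex space includes self-adjointness, as all the numbers
  \<open>\<langle>v, A v\<rangle>\<close> are required to be real.\<close>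

definition positive_op :: "complex^'i^'i \<Rightarrow> bool" where
  "positive_op A \<longleftrightarrow> (\<forall>v. cinner v (A *v v) \<in> \<real>\<^sub>\<ge>\<^sub>0)"

definition conj_by :: "complex^'i^'i \<Rightarrow> complex^'i^'i \<Rightarrow> complex^'i^'i" where
  "conj_by V \<rho> = V ** \<rho> ** dagger V"

definition density_operators :: "(complex^'i^'i) set" where
  "density_operators = {\<rho>. positive_op \<rho> \<and> trace \<rho> = 1}"

definition pure_states :: "(complex^'i^'i) set" where
  "pure_states = {(\<chi> i j. \<psi> $ i * cnj (\<psi> $ j)) | \<psi>. cinner \<psi> \<psi> = 1}"

definition tensor_ops :: "('n::finite \<Rightarrow> complex^'d^'d) \<Rightarrow> complex^('n \<Rightarrow> 'd)^('n \<Rightarrow> 'd)" where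
  "tensor_ops A = (\<chi> i j. \<Prod>k\<in>UNIV. A k $ i k $ j k)"

definition tensor_power :: "complex^'d^'d \<Rightarrow> complex^('n::finite \<Rightarrow> 'd)^('n \<Rightarrow> 'd)" where
  "tensor_power \<rho> = tensor_ops (\<lambda>_. \<rho>)"

definition von_neumann_algebra :: "(complex^'d^'d) set \<Rightarrow> bool" where
  "von_neumann_algebra \<A> \<longleftrightarrow> cmat.subspace \<A> \<and> mat 1 \<in> \<A> \<and>
     (\<forall>A\<in>\<A>. \<forall>B\<in>\<A>. A ** B \<in> \<A>) \<and> (\<forall>A\<in>\<A>. dagger A \<in> \<A>)"

definition gauge_group :: "(complex^'d^'d) set \<Rightarrow> (complex^'d^'d) set" where
  "gauge_group \<A> = {V. unitary V \<and> (\<forall>A\<in>\<A>. V ** A = A ** V)}"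

definition algebra_tensor_power ::
    "(complex^'d^'d) set \<Rightarrow> (complex^('n::finite \<Rightarrow> 'd)^('n \<Rightarrow> 'd)) set" where
  "algebra_tensor_power \<A> = cmat.span {tensor_ops A | A. \<forall>k. A k \<in> \<A>}"

text \<open>A family \<open>X i j\<close> with \<open>i, j < k\<close> is the block matrix of the operator
  \<open>\<Sum>i j. E\<^sub>i\<^sub>j \<otimes> X i j\<close> in \<open>End(\<complex>\<^sup>k) \<otimes> End(H)\<close>, and \<open>id \<otimes> E\<close> acts on it blockwise.\<close>

definition block_positive :: "nat \<Rightarrow> (nat \<Rightarrow> nat \<Rightarrow> complex^'i^'i) \<Rightarrow> bool" where
  "block_positive k X \<longleftrightarrow>
     (\<forall>v. (\<Sum>i<k. \<Sum>j<k. cinner (v i) (X i j *v v j)) \<in> \<real>\<^sub>\<ge>\<^sub>0)"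

definition completely_positive :: "(complex^'i^'i \<Rightarrow> complex^'i^'i) \<Rightarrow> bool" where
  "completely_positive E \<longleftrightarrow>
     (\<forall>k X. block_positive k X \<longrightarrow> block_positive k (\<lambda>i j. E (X i j)))"

definition quantum_channel :: "(complex^'i^'i \<Rightarrow> complex^'i^'i) \<Rightarrow> bool" where
  "quantum_channel E \<longleftrightarrow> Vector_Spaces.linear cscale cscale E \<and> completely_positive E \<and>
     (\<forall>X. trace (E X) = trace X)"

text \<open>Only \<open>space N\<close> and \<open>sets N\<close> of the outcome space \<open>N\<close> are used.\<close>

definition povm :: "'w measure \<Rightarrow> ('w set \<Rightarrow> complex^'i^'i) \<Rightarrow> bool" where
  "povm N M \<longleftrightarrow> (\<forall>B\<in>sets N. positive_op (M B)) \<and>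
     (\<forall>B::nat \<Rightarrow> 'w set. range B \<subseteq> sets N \<longrightarrow> disjoint_family B \<longrightarrow>
        (\<lambda>i. M (B i)) sums M (\<Union>i. B i)) \<and>
     M (space N) = mat 1"

definition reference_measure :: "(complex^'d^'d) measure \<Rightarrow> bool" where
  "reference_measure D \<longleftrightarrow> space D = density_operators \<and>
     sets D = sets (restrict_space borel density_operators) \<and>
     (\<forall>V. unitary V \<longrightarrow> distr D D (conj_by V) = D)"

definition prior_density :: "(complex^'d^'d) measure \<Rightarrow> (complex^'d^'d \<Rightarrow> real) \<Rightarrow> bool" where
  "prior_density D p \<longleftrightarrow> p \<in> borel_measurable D \<and> (\<forall>\<rho>\<in>space D. 0 \<le> p \<rho>) \<and>
     (\<integral>\<^sup>+ \<rho>. ennreal (p \<rho>) \<partial>D) = 1"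

definition prior_supp :: "(complex^'d^'d \<Rightarrow> real) \<Rightarrow> (complex^'d^'d) set" where
  "prior_supp p = {\<rho>\<in>density_operators. p \<rho> \<noteq> 0}"

text \<open>The values of \<open>s\<close> outside \<open>prior_supp p\<close> are irrelevant throughout.\<close>

definition parameters ::
    "(complex^'d^'d) measure \<Rightarrow> (complex^'d^'d \<Rightarrow> real) \<Rightarrow> (complex^'d^'d \<Rightarrow> real^'l) \<Rightarrow> bool" where
  "parameters D p s \<longleftrightarrow> s \<in> borel_measurable (restrict_space D (prior_supp p))"

definition prior_symmetry :: "(complex^'d^'d) set \<Rightarrow> (complex^'d^'d \<Rightarrow> real) \<Rightarrow> bool" where
  "prior_symmetry H p \<longleftrightarrow> (\<forall>V\<in>H. \<forall>\<rho>\<in>density_operators. p (conj_by V \<rho>) = p \<rho>)"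

definition parameter_symmetry ::
    "(complex^'d^'d) set \<Rightarrow> (complex^'d^'d \<Rightarrow> real) \<Rightarrow> (complex^'d^'d \<Rightarrow> real^'l) \<Rightarrow> bool" where
  "parameter_symmetry H p s \<longleftrightarrow> (\<forall>V\<in>H. \<forall>\<rho>\<in>prior_supp p. s (conj_by V \<rho>) = s \<rho>)"

definition parameter_event ::
    "(complex^'d^'d \<Rightarrow> real) \<Rightarrow> (complex^'d^'d \<Rightarrow> real^'l) \<Rightarrow> (real^'l) set \<Rightarrow> (complex^'d^'d) set" where
  "parameter_event p s \<Delta> = {\<rho>\<in>prior_supp p. s \<rho> \<in> \<Delta>}"

definition event_prob ::
    "(complex^'d^'d) measure \<Rightarrow> (complex^'d^'d \<Rightarrow> real) \<Rightarrow> (complex^'d^'d \<Rightarrow> real^'l) \<Rightarrow>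
     (real^'l) set \<Rightarrow> real" where
  "event_prob D p s \<Delta> = (LINT \<rho>:parameter_event p s \<Delta>|D. p \<rho>)"

text \<open>Outcome probabilities are complex-valued, being traces; they are in fact real and nonnegative.\<close>

definition outcome_prob ::
    "(complex^('n::finite \<Rightarrow> 'd)^('n \<Rightarrow> 'd) \<Rightarrow> complex^('n \<Rightarrow> 'd)^('n \<Rightarrow> 'd)) \<Rightarrow>
     ('w set \<Rightarrow> complex^('n \<Rightarrow> 'd)^('n \<Rightarrow> 'd)) \<Rightarrow> 'w set \<Rightarrow> complex^'d^'d \<Rightarrow> complex" where
  "outcome_prob E M B \<rho> = trace (M B ** E (tensor_power \<rho>))"

definition cond_outcome_prob ::
    "(complex^'d^'d) measure \<Rightarrow> (complex^'d^'d \<Rightarrow> real) \<Rightarrow> (complex^'d^'d \<Rightarrow> real^'l) \<Rightarrow>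
     (complex^('n::finite \<Rightarrow> 'd)^('n \<Rightarrow> 'd) \<Rightarrow> complex^('n \<Rightarrow> 'd)^('n \<Rightarrow> 'd)) \<Rightarrow>
     ('w set \<Rightarrow> complex^('n \<Rightarrow> 'd)^('n \<Rightarrow> 'd)) \<Rightarrow> 'w set \<Rightarrow> (real^'l) set \<Rightarrow> complex" where
  "cond_outcome_prob D p s E M B \<Delta> =
     1 / complex_of_real (event_prob D p s \<Delta>) *
     (LINT \<rho>:parameter_event p s \<Delta>|D. complex_of_real (p \<rho>) * outcome_prob E M B \<rho>)"

end

theory Submission
  imports Defs
begin

text \<open>
  Let \<open>P\<close> project onto the symmetric subspace and let \<open>B\<close> be the algebra of permutation invariant elements
  of \<open>\<A> \<otimes> \<dots> \<otimes> \<A>\<close>. The states \<open>\<rho>\<^sup>\<otimes>\<^sup>n\<close> averaged over a parameter event form an operator \<open>\<sigma> = P \<sigma> P\<close> that commutes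
  with \<open>V \<otimes> \<dots> \<otimes> V\<close> for every gauge unitary \<open>V\<close>, and a double commutant argument gives \<open>\<sigma> \<in> P B\<close>. So it suffices
  to find a positive unital linear map \<open>L\<close> into \<open>B\<close> with \<open>tr (L X P Y) = tr (X P Y)\<close> for all \<open>Y \<in> B\<close>; then
  \<open>M' = L \<circ> M\<close>. As \<open>P\<close> commutes with \<open>B\<close>, the map \<open>Y \<mapsto> P Y\<close> is a homomorphism of star algebras, injective on
  the ideal \<open>J\<close> complementary to its kernel, and \<open>L\<close> is the conditional expectation onto \<open>P B\<close> followed by
  the inverse of \<open>J \<rightarrow> P B\<close>, corrected on the kernel to be unital.

  No Haar measure is used: the conditional expectations are Hilbert--Schmidt orthogonal projections onto
  star algebras.
\<close>

section \<open>Complex matrices and positive operators\<close>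

text \<open>Projecting onto \<open>P B\<close> does not finish the proof, because \<open>P\<close>
  need not lie in the tensor power of \<open>\<A>\<close>; this forces the lift back to
  \<open>B\<close>. Purity of the states confines \<sigma> to the symmetric subspace, on which
  permutations act trivially. The commutant of \<open>B\<close> is spanned by products of elements
  of the commutant of \<open>\<A>\<close> followed by permutations, so after compression by
  \<open>P\<close> only symmetrized products are left, and \<sigma> has to commute with these. The
  symmetry supplies less at the outset: \<sigma> commutes with
  \<open>V \<otimes> \<dots> \<otimes> V\<close> for gauge unitaries \<open>V\<close>. The gap is
  closed infinitesimally. Differentiating along Cayley transforms shows that \<sigma> commutes with
  the sums over all sites of one element acting at a single site, and every symmetrized product is a
  polynomial in such sums. Positivity of the lift is tested on an element of \<open>J\<close> that
  left multiplication by \<open>L0 M\<close> scales by a negative number, so no square root or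
  spectral projection is formed.\<close>

lemma cscale_component [simp]: "cscale c A $ i $ j = c * A $ i $ j"
  by (simp add: cscale_def)

lemma matrix_mult_component: "(A ** B) $ i $ j = (\<Sum>k\<in>UNIV. A $ i $ k * B $ k $ j)"
  by (simp add: matrix_matrix_mult_def)

lemma mat_component: "mat c $ i $ j = (if i = j then c else 0)"
  by (simp add: mat_def)

lemma dagger_component [simp]: "dagger A $ i $ j = cnj (A $ j $ i)"
  by (simp add: dagger_def)

lemma dagger_dagger [simp]: "dagger (dagger A) = A"
  by (simp add: vec_eq_iff)

lemma dagger_mult: "dagger (A ** B) = dagger B ** dagger A"
  by (simp add: vec_eq_iff matrix_mult_component mult.commute)

lemma dagger_add: "dagger (A + B) = dagger A + dagger B"
  and dagger_diff: "dagger (A - B) = dagger A - dagger B"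
  and dagger_zero [simp]: "dagger 0 = 0"
  and dagger_mat_1 [simp]: "dagger (mat 1) = mat 1"
  and dagger_cscale: "dagger (cscale c A) = cscale (cnj c) (dagger A)"
  and dagger_sum: "dagger (\<Sum>x\<in>S. F x) = (\<Sum>x\<in>S. dagger (F x))"
  by (auto simp: vec_eq_iff mat_component)

lemma mult_cscale_left [simp]: "cscale c A ** B = cscale c (A ** B)"
  and mult_cscale_right [simp]: "A ** cscale c B = cscale c (A ** B)"
  by (simp_all add: vec_eq_iff matrix_mult_component sum_distrib_left algebra_simps)

lemma mult_diff_left: "(A - B) ** C = A ** C - B ** C"
  and mult_diff_right: "A ** (B - C) = A ** B - A ** C"
  and mult_add_left: "(A + B) ** C = A ** C + B ** C"
  and mult_add_right: "A ** (B + C) = A ** B + A ** C"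
  and mult_minus_left: "- A ** B = - (A ** B)"
  and mult_minus_right: "A ** - B = - (A ** B)"
  for A :: "complex^'i^'i"
  by (simp_all add: vec_eq_iff matrix_mult_component algebra_simps sum.distrib sum_subtractf sum_negf)

lemma mult_zero_left [simp]: "0 ** A = 0"
  and mult_zero_right [simp]: "A ** 0 = 0"
  for A :: "complex^'i^'i"
  by (simp_all add: vec_eq_iff matrix_mult_component)

lemma mult_sum_left: "(\<Sum>x\<in>S. F x) ** C = (\<Sum>x\<in>S. F x ** C)"
  and mult_sum_right: "C ** (\<Sum>x\<in>S. F x) = (\<Sum>x\<in>S. C ** F x)"
  for C :: "complex^'i^'i"
  by (induction S rule: infinite_finite_induct) (simp_all add: mult_add_left mult_add_right)

lemma scaleR_conv_cscale: "r *\<^sub>R A = cscale (of_real r) A"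
  unfolding vec_eq_iff by (simp add: scaleR_conv_of_real[where 'a=complex])

lemma trace_zero [simp]: "trace (0 :: complex^'i^'i) = 0"
  by (simp add: trace_def)

lemma trace_cscale: "trace (cscale c A) = c * trace A"
  by (simp add: trace_def sum_distrib_left)

lemma trace_sum: "trace (\<Sum>x\<in>S. F x) = (\<Sum>x\<in>S. trace (F x :: complex^'i^'i))"
  by (induction S rule: infinite_finite_induct) (simp_all add: trace_add)

lemma trace_dagger: "trace (dagger A) = cnj (trace A)"
  by (simp add: trace_def)

text \<open>Unlike \<open>trace_mul_sym\<close>, whose two sides differ in their types, this is a permutative rewrite rule.\<close>

lemma trace_commute: "trace (A ** B) = trace (B ** A)" for A B :: "complex^'i^'i"
  by (rule trace_mul_sym)

lemma trace_cyclic: "trace (A ** B ** C) = trace (C ** A ** B)" for A B C :: "complex^'i^'i"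
  using trace_commute [of "A ** B" C] by (simp add: matrix_mul_assoc)

lemma linear_cscale: "linear (cscale c)"
  by (rule linearI) (simp_all add: vec_eq_iff algebra_simps)

lemma linear_trace: "linear (trace :: complex^'i^'i \<Rightarrow> complex)"
  by (rule linearI) (simp_all add: trace_add scaleR_conv_cscale trace_cscale scaleR_conv_of_real[where 'a=complex])

lemma linear_mult_left: "linear (\<lambda>X :: complex^'i^'i. A ** X)" for A :: "complex^'i^'i"
  by (rule linearI) (simp_all add: mult_add_right scaleR_conv_cscale)

lemma linear_mult_right: "linear (\<lambda>X :: complex^'i^'i. X ** A)" for A :: "complex^'i^'i"
  by (rule linearI) (simp_all add: mult_add_left scaleR_conv_cscale)

text \<open>The Euclidean inner product of the matrix type is the real part of the Hilbert--Schmidt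
  product, so real orthogonal decompositions can be used for the latter.\<close>

lemma inner_matrix_eq_trace: "A \<bullet> B = Re (trace (dagger A ** B))"
  for A B :: "complex^'i^'i"
proof -
  have "A \<bullet> B = (\<Sum>i\<in>UNIV. \<Sum>j\<in>UNIV. Re (cnj (A $ i $ j) * B $ i $ j))"
    by (simp add: inner_vec_def inner_complex_def)
  also have "\<dots> = (\<Sum>j\<in>UNIV. \<Sum>i\<in>UNIV. Re (cnj (A $ i $ j) * B $ i $ j))"
    by (rule sum.swap)
  finally show ?thesis
    by (simp add: trace_def matrix_mult_component)
qed

lemma trace_mult_dagger_eq_0_iff: "trace (A ** dagger A) = 0 \<longleftrightarrow> A = 0"
proof
  assume "trace (A ** dagger A) = 0"
  then have "dagger A \<bullet> dagger A = 0" by (simp add: inner_matrix_eq_trace)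
  then have "dagger A = 0" by simp
  then show "A = 0" by (metis dagger_dagger dagger_zero)
qed simp

lemma trace_mult_eq_0_imp_eq_0:
  fixes X :: "complex^'i^'i"
  assumes "\<And>Y. trace (X ** Y) = 0"
  shows "X = 0"
  using assms[of "dagger X"] by (simp add: trace_mult_dagger_eq_0_iff)

section \<open>The complex inner product and positivity\<close>

lemma cinner_real_inner: "Re (cinner v w) = v \<bullet> w"
  by (simp add: cinner_def inner_vec_def inner_complex_def)

lemma cinner_dagger: "cinner v (A *v w) = cinner (dagger A *v v) w"
proof -
  have "cinner v (A *v w) = (\<Sum>i\<in>UNIV. \<Sum>j\<in>UNIV. cnj (v $ i) * A $ i $ j * w $ j)"
    by (simp add: cinner_def matrix_vector_mult_def sum_distrib_left mult.assoc)
  also have "\<dots> = (\<Sum>j\<in>UNIV. \<Sum>i\<in>UNIV. cnj (v $ i) * A $ i $ j * w $ j)"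
    by (rule sum.swap)
  also have "\<dots> = cinner (dagger A *v v) w"
    by (simp add: cinner_def matrix_vector_mult_def sum_distrib_left mult_ac)
  finally show ?thesis .
qed

lemma cinner_commute: "cinner w v = cnj (cinner v w)"
  by (simp add: cinner_def mult.commute)

lemma cinner_add_left: "cinner (u + v) w = cinner u w + cinner v w"
  and cinner_add_right: "cinner w (u + v) = cinner w u + cinner w v"
  and cinner_scale_left: "cinner (c *s v) w = cnj c * cinner v w"
  and cinner_scale_right: "cinner v (c *s w) = c * cinner v w"
  by (simp_all add: cinner_def algebra_simps sum.distrib sum_distrib_left)

lemma cinner_self_nonneg: "cinner v v \<in> \<real>\<^sub>\<ge>\<^sub>0"
proof -
  have "Im (cinner v v) = 0" by (simp add: cinner_def)
  then show ?thesis by (simp add: complex_nonneg_Reals_iff cinner_real_inner)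
qed

lemma positive_op_add: "positive_op A \<Longrightarrow> positive_op B \<Longrightarrow> positive_op (A + B)"
  by (simp add: positive_op_def matrix_vector_mult_add_rdistrib cinner_add_right)

lemma positive_op_cscale:
  assumes "positive_op A" "c \<in> \<real>\<^sub>\<ge>\<^sub>0"
  shows "positive_op (cscale c A)"
proof -
  have "cscale c A *v v = c *s (A *v v)" for v
    by (simp add: vec_eq_iff matrix_vector_mult_def sum_distrib_left mult.assoc)
  with assms show ?thesis
    by (simp add: positive_op_def cinner_scale_right)
qed

lemma positive_op_dagger_mult: "positive_op (dagger A ** A)"
  by (simp add: positive_op_def cinner_dagger[of _ "dagger A"] cinner_self_nonneg
      matrix_vector_mul_assoc[symmetric])

lemma positive_op_congruence:
  assumes "positive_op M"
  shows "positive_op (dagger X ** M ** X)"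
  using assms
  by (simp add: positive_op_def matrix_vector_mul_assoc[symmetric] cinner_dagger[of _ "dagger X"])

lemma trace_nonneg:
  assumes "positive_op M"
  shows "trace M \<in> \<real>\<^sub>\<ge>\<^sub>0"
proof -
  have "cinner (axis i 1) (M *v axis i 1) = M $ i $ i" for i
    by (simp add: cinner_def matrix_vector_mult_def axis_def if_distrib[of cnj]
        if_distrib[of "\<lambda>x. x * _"] if_distrib[of "\<lambda>x. _ * x"] cong: if_cong)
  with assms have "M $ i $ i \<in> \<real>\<^sub>\<ge>\<^sub>0" for i
    unfolding positive_op_def by metis
  then show ?thesis
    by (auto simp: trace_def complex_nonneg_Reals_iff sum_nonneg)
qed

text \<open>Polarization: the quadratic form of \<open>A - dagger A\<close> vanishes, and over the
  complex numbers the test vectors \<open>v + w\<close> and \<open>v + \<i> *s w\<close> together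
  recover the whole sesquilinear form from it.\<close>

lemma positive_op_self_adjoint:
  assumes "positive_op A"
  shows "dagger A = A"
proof -
  have real: "cinner v (A *v v) = cinner v (dagger A *v v)" for v
  proof -
    have "cinner v (dagger A *v v) = cnj (cinner v (A *v v))"
      using cinner_dagger[of v "dagger A" v] cinner_commute[of "A *v v" v] by simp
    moreover have "Im (cinner v (A *v v)) = 0"
      using assms by (simp add: positive_op_def complex_nonneg_Reals_iff)
    ultimately show ?thesis by (simp add: complex_eq_iff)
  qed
  define B where "B = A - dagger A"
  have quad: "cinner v (B *v v) = 0" for v
    using real[of v] unfolding B_def
    by (simp add: matrix_vector_mult_diff_rdistrib cinner_def algebra_simps sum_subtractf)
  have polar: "cinner v (B *v w) = 0" for v w
  proof -
    have "cinner v (B *v w) + cinner w (B *v v) = 0"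
      using quad[of "v + w"] quad[of v] quad[of w]
      by (simp add: matrix_vector_right_distrib cinner_add_left cinner_add_right add.commute)
    moreover have "\<i> * cinner v (B *v w) - \<i> * cinner w (B *v v) = 0"
      using quad[of "v + \<i> *s w"] quad[of v] quad[of w]
      by (simp add: matrix_vector_right_distrib cinner_add_left cinner_add_right
          vector_scalar_commute cinner_scale_left cinner_scale_right)
    ultimately show ?thesis by (simp add: algebra_simps)
  qed
  have "B *v w = 0" for w
    using polar[of "B *v w" w] cinner_real_inner[of "B *v w" "B *v w"] by simp
  then have "B = 0" by (simp add: matrix_eq)
  then show ?thesis by (simp add: B_def)
qed

text \<open>The minimum of the quadratic form on the unit sphere is an eigenvalue.\<close>

lemma self_adjoint_negative_eigenvector:
  assumes herm: "dagger A = A" and npos: "\<not> positive_op A"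
  obtains v \<mu> where "v \<noteq> 0" "\<mu> < 0" "A *v v = of_real \<mu> *s v"
proof -
  define f where "f v = v \<bullet> (A *v v)" for v
  have lin: "linear ((*v) A)" by simp
  have sym: "x \<bullet> (A *v y) = (A *v x) \<bullet> y" for x y
    using cinner_dagger[of x A y] herm by (metis cinner_real_inner)
  obtain u where u: "f u < 0"
  proof -
    obtain w where w: "cinner w (A *v w) \<notin> \<real>\<^sub>\<ge>\<^sub>0"
      using npos by (auto simp: positive_op_def)
    have "cinner w (A *v w) = cnj (cinner w (A *v w))"
      using cinner_dagger[of w A w] herm by (metis cinner_commute)
    then have "Im (cinner w (A *v w)) = 0" by (simp add: complex_eq_iff)
    with w have "f w < 0"
      by (simp add: complex_nonneg_Reals_iff f_def cinner_real_inner)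
    then show ?thesis by (rule that)
  qed
  have cont: "continuous_on (sphere 0 1) f"
    unfolding f_def by (intro continuous_intros linear_continuous_on lin
        linear_conv_bounded_linear[THEN iffD1])
  have "u \<noteq> 0" using u by (auto simp: f_def)
  then have "u /\<^sub>R norm u \<in> sphere 0 1" by simp
  then obtain v where v: "v \<in> sphere 0 1" and min: "\<And>w. w \<in> sphere 0 1 \<Longrightarrow> f v \<le> f w"
    using continuous_attains_inf[OF compact_sphere _ cont] by blast
  \<comment> \<open>The homogeneous form of minimality: \<open>g\<close> is nonnegative on the whole
    space and zero at \<open>v\<close>, so its first variation at \<open>v\<close> vanishes with no
    constraint to the sphere.\<close>
  define g where "g w = f w - f v * (w \<bullet> w)" for w
  have f_scale: "f (c *\<^sub>R w) = c\<^sup>2 * f w" for c w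
    by (simp add: f_def linear_cmul[OF lin] power2_eq_square)
  have g_nonneg: "g w \<ge> 0" for w
  proof (cases "w = 0")
    case True then show ?thesis by (simp add: g_def f_def)
  next
    case False
    then have "f v \<le> f (w /\<^sub>R norm w)" by (intro min) simp
    then have "f v \<le> f w / (w \<bullet> w)"
      by (simp add: f_scale power2_norm_eq_inner divide_inverse power_inverse mult.commute)
    with False show ?thesis by (simp add: g_def pos_le_divide_eq mult.commute)
  qed
  have vv: "v \<bullet> v = 1" using v by (simp add: dot_square_norm)
  have critical: "w \<bullet> (A *v v - f v *\<^sub>R v) = 0" for w
  proof -
    define b where "b = w \<bullet> (A *v v - f v *\<^sub>R v)"
    have expand: "g (v + t *\<^sub>R w) = 2 * t * b + t\<^sup>2 * g w" for t
    proof -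
      have "f (v + t *\<^sub>R w) = f v + 2 * t * (w \<bullet> (A *v v)) + t\<^sup>2 * f w"
        using sym[of v w]
        by (simp add: f_def linear_add[OF lin] linear_cmul[OF lin] inner_add_left inner_add_right
            power2_eq_square inner_commute algebra_simps)
      then show ?thesis
        by (simp add: g_def b_def vv inner_add_left inner_add_right inner_diff_right
            power2_eq_square inner_commute[of v w] algebra_simps)
    qed
    have "b = 0"
    proof (rule ccontr)
      assume "b \<noteq> 0"
      \<comment> \<open>Adding 1 keeps the denominator positive even if \<open>g w = 0\<close>;
        \<open>t = - b / c\<close> minimizes \<open>2 * t * b + c * t\<^sup>2\<close>, which bounds
        the expansion of \<open>g\<close> from above.\<close>
      define c where "c = g w + 1"
      define t where "t = - b / c"
      have "c > 0" using g_nonneg[of w] by (simp add: c_def)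
      then have "2 * t * b + t\<^sup>2 * (c - 1) = - (b\<^sup>2 * (c + 1)) / c\<^sup>2"
        by (simp add: t_def field_simps power2_eq_square)
      also have "\<dots> < 0"
        using \<open>b \<noteq> 0\<close> \<open>c > 0\<close> by (intro divide_neg_pos) auto
      finally have "2 * t * b + t\<^sup>2 * g w < 0" by (simp add: c_def)
      then show False using g_nonneg[of "v + t *\<^sub>R w"] expand[of t] by simp
    qed
    then show ?thesis by (simp add: b_def)
  qed
  have "A *v v = f v *\<^sub>R v"
    using critical[of "A *v v - f v *\<^sub>R v"] by simp

  then have "A *v v = of_real (f v) *s v"
    by (simp add: vec_eq_iff scaleR_conv_of_real[where 'a=complex])
  moreover have "f v < 0"
    using min[OF \<open>u /\<^sub>R norm u \<in> sphere 0 1\<close>] u \<open>u \<noteq> 0\<close>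
    by (smt (verit) f_scale mult_pos_neg norm_eq_zero inverse_nonzero_iff_nonzero zero_less_power2)
  moreover have "v \<noteq> 0" using v by auto
  ultimately show ?thesis using that by blast
qed

section \<open>Star algebras and the double commutant theorem\<close>

definition star_subspace :: "(complex^'i^'i) set \<Rightarrow> bool" where
  "star_subspace S \<longleftrightarrow> cmat.subspace S \<and> (\<forall>A\<in>S. dagger A \<in> S)"

text \<open>No unit is demanded, so that the compression of an algebra by a projection
  \<open>P\<close> qualifies, whose unit is \<open>P\<close> instead of
  \<open>mat 1\<close>.\<close>

definition star_algebra :: "(complex^'i^'i) set \<Rightarrow> bool" where
  "star_algebra S \<longleftrightarrow> star_subspace S \<and> (\<forall>A\<in>S. \<forall>B\<in>S. A ** B \<in> S)"

definition commutant :: "(complex^'i^'i) set \<Rightarrow> (complex^'i^'i) set" where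
  "commutant S = {X. \<forall>A\<in>S. A ** X = X ** A}"

lemma star_subspaceD:
  assumes "star_subspace S"
  shows star_subspace_0: "0 \<in> S"
    and star_subspace_add: "\<And>A B. A \<in> S \<Longrightarrow> B \<in> S \<Longrightarrow> A + B \<in> S"
    and star_subspace_diff: "\<And>A B. A \<in> S \<Longrightarrow> B \<in> S \<Longrightarrow> A - B \<in> S"
    and star_subspace_cscale: "\<And>c A. A \<in> S \<Longrightarrow> cscale c A \<in> S"
    and star_subspace_sum: "\<And>F I. (\<And>i. i \<in> I \<Longrightarrow> F i \<in> S) \<Longrightarrow> (\<Sum>i\<in>I. F i) \<in> S"
    and star_subspace_dagger: "\<And>A. A \<in> S \<Longrightarrow> dagger A \<in> S"
    and star_subspace_real: "subspace S"
  using assms unfolding star_subspace_def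
  by (auto intro: cmat.subspace_0 cmat.subspace_add cmat.subspace_diff cmat.subspace_scale
      cmat.subspace_sum simp: subspace_def scaleR_conv_cscale)

lemma star_subspaceI:
  assumes "0 \<in> S" "\<And>A B. A \<in> S \<Longrightarrow> B \<in> S \<Longrightarrow> A + B \<in> S"
    and "\<And>c A. A \<in> S \<Longrightarrow> cscale c A \<in> S" "\<And>A. A \<in> S \<Longrightarrow> dagger A \<in> S"
  shows "star_subspace S"
  using assms by (auto simp: star_subspace_def intro!: cmat.subspaceI)

lemma star_algebra_imp_subspace: "star_algebra S \<Longrightarrow> star_subspace S"
  and star_algebra_mult: "star_algebra S \<Longrightarrow> A \<in> S \<Longrightarrow> B \<in> S \<Longrightarrow> A ** B \<in> S"
  by (auto simp: star_algebra_def)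

lemma commutantD: "X \<in> commutant S \<Longrightarrow> A \<in> S \<Longrightarrow> A ** X = X ** A"
  by (simp add: commutant_def)

lemma commutantI: "(\<And>A. A \<in> S \<Longrightarrow> A ** X = X ** A) \<Longrightarrow> X \<in> commutant S"
  by (simp add: commutant_def)

lemma mat_1_in_commutant [simp]: "mat 1 \<in> commutant S"
  by (simp add: commutant_def)

lemma star_algebra_commutant:
  assumes "\<And>A. A \<in> S \<Longrightarrow> dagger A \<in> S"
  shows "star_algebra (commutant S)"
proof -
  have "dagger X \<in> commutant S" if "X \<in> commutant S" for X
  proof (rule commutantI)
    fix A assume "A \<in> S"
    then have "dagger A ** X = X ** dagger A"
      using that assms by (simp add: commutantD)
    then have "dagger (dagger A ** X) = dagger (X ** dagger A)" by simp
    then show "A ** dagger X = dagger X ** A" by (simp add: dagger_mult)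
  qed
  moreover have "X ** Y \<in> commutant S" if "X \<in> commutant S" "Y \<in> commutant S" for X Y
    using that by (auto simp: commutant_def matrix_mul_assoc)
      (metis matrix_mul_assoc)
  ultimately show ?thesis
    unfolding star_algebra_def
    by (auto intro!: star_subspaceI simp: commutant_def mult_add_left mult_add_right)
qed

text \<open>As \<open>S\<close> will be closed under adjoints, the condition says that \<open>X - A\<close> is Hilbert--Schmidt orthogonal
  to \<open>S\<close>.\<close>

definition hs_proj :: "(complex^'i^'i) set \<Rightarrow> complex^'i^'i \<Rightarrow> complex^'i^'i" where
  "hs_proj S X = (SOME A. A \<in> S \<and> (\<forall>Y\<in>S. trace ((X - A) ** Y) = 0))"

lemma hs_proj:
  assumes S: "star_subspace S"
  shows hs_proj_in: "hs_proj S X \<in> S"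
    and hs_proj_trace: "\<And>Y. Y \<in> S \<Longrightarrow> trace (hs_proj S X ** Y) = trace (X ** Y)"
proof -
  note real = star_subspace_real[OF S]
  obtain A Z where A: "A \<in> span S" and Z: "\<And>W. W \<in> span S \<Longrightarrow> orthogonal Z W" and X: "X = A + Z"
    using orthogonal_subspace_decomp_exists[of S X] by metis
  have "trace (Z ** Y) = 0" if "Y \<in> S" for Y
  proof -
    have re: "Re (trace (Z ** W)) = 0" if "W \<in> S" for W
    proof -
      have "dagger W \<in> span S" using that S by (simp add: span_base star_subspace_dagger)
      from Z[OF this] have "dagger W \<bullet> Z = 0"
        unfolding orthogonal_def by (simp only: inner_commute[of "dagger W" Z])
      then show ?thesis by (simp add: inner_matrix_eq_trace trace_commute)
    qed
    \<comment> \<open>\<open>S\<close> is a complex subspace, so real orthogonality may also be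
      tested at \<open>\<i>\<close> times \<open>Y\<close>, which yields the imaginary part.\<close>
    have "Re (trace (Z ** cscale \<i> Y)) = 0"
      using that S by (intro re star_subspace_cscale)
    then have "Im (trace (Z ** Y)) = 0" by (simp add: trace_cscale)
    with re[OF that] show ?thesis by (simp add: complex_eq_iff)
  qed
  moreover have "A \<in> S" using A real by (simp add: span_eq_iff[THEN iffD2])
  moreover have "X - A = Z" using X by simp
  ultimately have "\<exists>A. A \<in> S \<and> (\<forall>Y\<in>S. trace ((X - A) ** Y) = 0)" by metis
  from someI_ex[OF this]
  have *: "hs_proj S X \<in> S \<and> (\<forall>Y\<in>S. trace ((X - hs_proj S X) ** Y) = 0)"
    unfolding hs_proj_def .
  then show "hs_proj S X \<in> S" by blast
  show "trace (hs_proj S X ** Y) = trace (X ** Y)" if "Y \<in> S" for Y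
    using * that by (simp add: mult_diff_left trace_sub)
qed

text \<open>The difference of two candidates lies in \<open>S\<close> and is orthogonal to
  \<open>S\<close>, in particular to itself. Linearity and \<open>S\<close>-linearity of the
  projection are all obtained by checking this characterization.\<close>

lemma hs_proj_unique:
  assumes S: "star_subspace S" and "A \<in> S"
    and "\<And>Y. Y \<in> S \<Longrightarrow> trace (A ** Y) = trace (X ** Y)"
  shows "hs_proj S X = A"
proof -
  let ?D = "hs_proj S X - A"
  have "?D \<in> S" using assms hs_proj_in star_subspace_diff by blast
  then have "dagger ?D \<in> S" using S star_subspace_dagger by blast
  then have "trace (?D ** dagger ?D) = 0"
    using assms by (simp add: mult_diff_left trace_sub hs_proj_trace)
  then show ?thesis by (simp add: trace_mult_dagger_eq_0_iff)
qed

lemma hs_proj_cscale: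
  assumes S: "star_subspace S"
  shows "hs_proj S (cscale c X) = cscale c (hs_proj S X)"
  using assms by (intro hs_proj_unique)
    (simp_all add: hs_proj_in hs_proj_trace star_subspace_cscale trace_cscale)

lemma hs_proj_sum:
  assumes S: "star_subspace S"
  shows "hs_proj S (\<Sum>i\<in>I. F i) = (\<Sum>i\<in>I. hs_proj S (F i))"
  using assms by (intro hs_proj_unique)
    (simp_all add: hs_proj_in hs_proj_trace star_subspace_sum mult_sum_left trace_sum)

lemma hs_proj_id:
  assumes "star_subspace S" "A \<in> S"
  shows "hs_proj S A = A"
  by (rule hs_proj_unique[OF assms]) (rule refl)

text \<open>The module property of a conditional expectation: cyclicity of the trace moves
  \<open>A\<close> over to the test element \<open>Y\<close>, and \<open>Y ** A\<close> is again in
  \<open>S\<close>.\<close>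

lemma hs_proj_mult_left:
  assumes S: "star_algebra S" and "A \<in> S"
  shows "hs_proj S (A ** X) = A ** hs_proj S X"
proof (rule hs_proj_unique)
  show "star_subspace S" using S by (rule star_algebra_imp_subspace)
  then show "A ** hs_proj S X \<in> S" using assms by (simp add: star_algebra_mult hs_proj_in)
  fix Y assume "Y \<in> S"
  then have "Y ** A \<in> S" using assms by (simp add: star_algebra_mult)
  then have "trace (hs_proj S X ** (Y ** A)) = trace (X ** (Y ** A))"
    using \<open>star_subspace S\<close> by (rule hs_proj_trace[rotated])
  then show "trace (A ** hs_proj S X ** Y) = trace (A ** X ** Y)"
    by (metis matrix_mul_assoc trace_cyclic)
qed

definition unit_matrix :: "'i \<Rightarrow> 'i \<Rightarrow> complex^'i^'i" where
  "unit_matrix i j = (\<chi> a b. if a = i \<and> b = j then 1 else 0)"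

lemma matrix_unit_expansion:
  "X = (\<Sum>i\<in>UNIV. \<Sum>j\<in>UNIV. cscale (X $ i $ j) (unit_matrix i j))"
proof -
  have "(\<Sum>j\<in>UNIV. X $ i $ j * unit_matrix i j $ a $ b) = (if i = a then X $ a $ b else 0)" for i a b
    by (simp add: unit_matrix_def if_distrib[of "\<lambda>x. _ * x"] cong: if_cong)
  then show ?thesis by (simp add: vec_eq_iff)
qed

text \<open>The projection onto \<open>S\<close> is left \<open>S\<close>-linear, so each of the blocks \<open>Q\<close> that describe it commutes
  with \<open>S\<close>; hence it is left linear over the double commutant.\<close>

theorem double_commutant:
  assumes S: "star_algebra S" and e: "e \<in> S" "T ** e = T" and T: "T \<in> commutant (commutant S)"
  shows "T \<in> S"
proof -
  note sub = star_algebra_imp_subspace[OF S]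
  \<comment> \<open>Coefficient blocks of the linear map \<open>hs_proj S\<close>: column
    \<open>l\<close> of the projection is the sum over \<open>j\<close> of \<open>Q j l\<close>
    applied to column \<open>j\<close> of the argument.\<close>
  define Q where "Q j l = (\<chi> p q. hs_proj S (unit_matrix q j) $ p $ l)" for j l
  have proj: "hs_proj S X $ p $ l = (\<Sum>j\<in>UNIV. (Q j l ** X) $ p $ j)" for X p l
  proof -
    have "hs_proj S X = (\<Sum>i\<in>UNIV. \<Sum>j\<in>UNIV. cscale (X $ i $ j) (hs_proj S (unit_matrix i j)))"
      by (subst matrix_unit_expansion[of X]) (simp add: hs_proj_sum hs_proj_cscale sub)
    then have "hs_proj S X $ p $ l = (\<Sum>i\<in>UNIV. \<Sum>j\<in>UNIV. X $ i $ j * Q j l $ p $ i)"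
      by (simp add: Q_def)
    also have "\<dots> = (\<Sum>j\<in>UNIV. \<Sum>i\<in>UNIV. X $ i $ j * Q j l $ p $ i)"
      by (rule sum.swap)
    finally show ?thesis
      by (simp add: matrix_mult_component mult.commute)
  qed
  have Q: "Q j l \<in> commutant S" for j l
  proof (rule commutantI)
    fix A assume A: "A \<in> S"
    show "A ** Q j l = Q j l ** A"
    proof (simp add: vec_eq_iff, intro allI)
      fix p q
      have "(A ** Q j l) $ p $ q = (A ** hs_proj S (unit_matrix q j)) $ p $ l"
        by (simp add: matrix_mult_component Q_def)
      also have "\<dots> = hs_proj S (A ** unit_matrix q j) $ p $ l"
        by (simp add: hs_proj_mult_left S A)
      also have "A ** unit_matrix q j = (\<Sum>r\<in>UNIV. cscale (A $ r $ q) (unit_matrix r j))"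
        by (simp add: vec_eq_iff matrix_mult_component unit_matrix_def
            if_distrib[of "\<lambda>x. _ * x"] if_conn(1) cong: if_cong)
      also have "hs_proj S \<dots> $ p $ l = (Q j l ** A) $ p $ q"
        by (simp add: hs_proj_sum hs_proj_cscale sub matrix_mult_component Q_def mult.commute)
      finally show "(A ** Q j l) $ p $ q = (Q j l ** A) $ p $ q" .
    qed
  qed
  have "hs_proj S (T ** e) $ p $ l = (T ** hs_proj S e) $ p $ l" for p l
  proof -
    have "hs_proj S (T ** e) $ p $ l = (\<Sum>j\<in>UNIV. (T ** (Q j l ** e)) $ p $ j)"
      using commutantD[OF T Q] by (simp add: proj matrix_mul_assoc)
    also have "\<dots> = (\<Sum>j\<in>UNIV. \<Sum>r\<in>UNIV. T $ p $ r * (Q j l ** e) $ r $ j)"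
      by (simp add: matrix_mult_component[of T])
    also have "\<dots> = (T ** hs_proj S e) $ p $ l"
      by (subst sum.swap) (simp add: matrix_mult_component[of T] proj sum_distrib_left)
    finally show ?thesis .
  qed
  \<comment> \<open>Project \<open>T = T ** e\<close>: \<open>T\<close> can be pulled out, and
    \<open>e\<close> is fixed because it lies in \<open>S\<close>, which leaves
    \<open>T ** e = T\<close>.\<close>
  then have "hs_proj S T = T"
    using e by (simp add: vec_eq_iff hs_proj_id sub)
  then show ?thesis using hs_proj_in[OF sub, of T] by simp
qed

section \<open>Lifting positive operators from a compression\<close>

text \<open>If left multiplication by \<open>A - \<mu>\<close> were injective on \<open>J\<close>, then \<open>A = (A - \<mu>) X\<close> for some \<open>X\<close>,
  which fails on an eigenvector for \<open>\<mu>\<close>.\<close>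

lemma negative_eigen_element:
  assumes J: "star_subspace J" and A: "A \<in> J" and ideal: "\<And>X. X \<in> J \<Longrightarrow> A ** X \<in> J"
    and herm: "dagger A = A" and npos: "\<not> positive_op A"
  obtains X \<mu> where "X \<in> J" "X \<noteq> 0" "\<mu> < 0" "A ** X = cscale (of_real \<mu>) X"
proof -
  obtain v \<mu> where v: "v \<noteq> 0" and mu: "\<mu> < 0" and eig: "A *v v = of_real \<mu> *s v"
    using self_adjoint_negative_eigenvector[OF herm npos] .
  note real = star_subspace_real[OF J]
  define T where "T X = A ** X - cscale (of_real \<mu>) X" for X
  have lin: "linear T"
    unfolding T_def by (intro linear_compose_sub linear_mult_left linear_cscale)
  have "\<not> inj_on T J"
  proof
    assume inj: "inj_on T J"
    \<comment> \<open>An injective linear map of the finite-dimensional space \<open>J\<close> into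
      itself is onto, so \<open>A\<close> is one of its values.\<close>
    have "dim (T ` J) = dim J"
      using lin inj real by (intro dim_image_eq) (simp_all add: span_eq_iff[THEN iffD2])
    moreover have "T ` J \<subseteq> J"
      using J ideal by (auto simp: T_def intro!: star_subspace_diff star_subspace_cscale)
    ultimately have "T ` J = J"
      using lin real by (intro subspace_dim_equal linear_subspace_image) auto
    then obtain X where X: "A = T X" using A by blast
    define w where "w = X *v v"
    have "cscale (of_real \<mu>) X *v v = of_real \<mu> *s w"
      by (simp add: w_def vec_eq_iff matrix_vector_mult_def sum_distrib_left mult.assoc)
    then have "T X *v v = A *v w - of_real \<mu> *s w"
      by (simp add: T_def w_def matrix_vector_mult_diff_rdistrib matrix_vector_mul_assoc)
    \<comment> \<open>Pairing with \<open>v\<close> gives the contradiction: by self-adjointness the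
      range of \<open>A - \<mu>\<close> is orthogonal to the eigenvector, while
      \<open>A *v v\<close> is a nonzero multiple of it.\<close>
    then have "cinner v (A *v v) = cinner v (A *v w - of_real \<mu> *s w)"
      using X by metis
    also have "\<dots> = cinner v (A *v w) - of_real \<mu> * cinner v w"
      by (simp add: cinner_def right_diff_distrib sum_subtractf sum_distrib_left mult.left_commute)
    also have "\<dots> = 0"
      using herm by (simp add: cinner_dagger[of v A] eig cinner_scale_left)
    finally have "cinner v v = 0"
      using mu by (simp add: eig cinner_scale_right)
    then show False using v cinner_real_inner[of v v] by simp
  qed
  then obtain X Y where XY: "X \<in> J" "Y \<in> J" "X \<noteq> Y" "T X = T Y"
    by (auto simp: inj_on_def)
  then have "T (X - Y) = 0" by (simp add: linear_diff[OF lin])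
  then have "A ** (X - Y) = cscale (of_real \<mu>) (X - Y)" by (simp add: T_def)
  moreover have "X - Y \<in> J" using XY J by (simp add: star_subspace_diff)
  ultimately show ?thesis using that[of "X - Y" \<mu>] mu XY by simp
qed

lemma star_subspace_compression:
  assumes S: "star_subspace S" and herm: "dagger P = P" and comm: "\<And>Y. Y \<in> S \<Longrightarrow> Y ** P = P ** Y"
  shows "star_subspace ((**) P ` S)"
proof (rule star_subspaceI)
  show "0 \<in> (**) P ` S" using S star_subspace_0 by force
next
  fix X Y assume "X \<in> (**) P ` S" "Y \<in> (**) P ` S"
  then show "X + Y \<in> (**) P ` S"
    using S by (auto simp: mult_add_right[symmetric] star_subspace_add intro!: imageI)
next
  fix c X assume "X \<in> (**) P ` S"
  then show "cscale c X \<in> (**) P ` S"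
    using S by (auto simp: mult_cscale_right[symmetric] star_subspace_cscale
        simp del: mult_cscale_right intro!: imageI)
next
  fix X assume "X \<in> (**) P ` S"
  then obtain Y where Y: "X = P ** Y" "Y \<in> S" by blast
  then have "dagger X = P ** dagger Y"
    using comm[OF star_subspace_dagger[OF S Y(2)]] by (simp add: dagger_mult herm)
  then show "dagger X \<in> (**) P ` S" using S Y by (simp add: star_subspace_dagger)
qed

text \<open>\<open>K\<close> is the kernel of the compression \<open>Y \<mapsto> P Y\<close> of \<open>B\<close>, and \<open>J\<close> is the ideal of \<open>B\<close> complementary
  to it, on which the compression is injective. The conditional expectation of \<open>P M P\<close> onto \<open>P B = P J\<close>
  is lifted to \<open>J\<close>, and a multiple of \<open>1 - L0 1\<close>, which the compression annihilates, restores the unit.\<close>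

lemma positive_lift:
  fixes P :: "complex^'i^'i"
  assumes B: "star_algebra B" and one: "mat 1 \<in> B"
    and idem: "P ** P = P" and herm: "dagger P = P" and comm: "P \<in> commutant B"
  obtains L where "linear L" "\<And>M. L M \<in> B" "\<And>M. positive_op M \<Longrightarrow> positive_op (L M)"
    "L (mat 1) = mat 1" "\<And>M Y. Y \<in> B \<Longrightarrow> trace (L M ** (P ** Y)) = trace (M ** (P ** Y))"
proof -
  note subB = star_algebra_imp_subspace[OF B]
  have PY: "Y ** P = P ** Y" if "Y \<in> B" for Y using commutantD[OF comm that] .
  have P_dagger: "P ** dagger Y = dagger (P ** Y)" if "Y \<in> B" for Y
    using that by (simp add: dagger_mult herm PY star_subspace_dagger[OF subB])
  define K where "K = {Y \<in> B. P ** Y = 0}"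
  define J where "J = {A \<in> B. \<forall>Y\<in>K. trace (A ** Y) = 0}"
  have JB: "A \<in> J \<Longrightarrow> A \<in> B" for A by (simp add: J_def)
  have subK: "star_subspace K"
    using subB by (intro star_subspaceI)
      (auto simp: K_def star_subspaceD mult_add_right P_dagger)
  have K_left: "X ** Y \<in> K" and K_right: "Y ** X \<in> K" if "X \<in> B" "Y \<in> K" for X Y
  proof -
    have "P ** (X ** Y) = X ** (P ** Y)" using that by (simp add: matrix_mul_assoc PY)
    then show "X ** Y \<in> K" using that by (simp add: K_def star_algebra_mult[OF B])
    show "Y ** X \<in> K" using that by (simp add: K_def star_algebra_mult[OF B] matrix_mul_assoc)
  qed
  have subJ: "star_subspace J"
  proof (rule star_subspaceI)
    fix A assume A: "A \<in> J"
    have "trace (dagger A ** Y) = cnj (trace (A ** dagger Y))" for Y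
      by (simp add: trace_dagger[symmetric] dagger_mult trace_commute)
    with A subB subK show "dagger A \<in> J"
      by (simp add: J_def star_subspace_dagger)
  qed (use subB in \<open>auto simp: J_def star_subspaceD mult_add_left trace_add trace_cscale\<close>)
  have J_left: "X ** A \<in> J" and J_right: "A ** X \<in> J" if "X \<in> B" "A \<in> J" for X A
  proof -
    have "trace (X ** A ** Y) = trace (A ** (Y ** X))"
      "trace (A ** X ** Y) = trace (A ** (X ** Y))" for Y
      by (metis trace_cyclic matrix_mul_assoc)+
    then show "X ** A \<in> J" "A ** X \<in> J"
      using that K_left K_right by (simp_all add: J_def star_algebra_mult[OF B])
  qed
  have J_0: "A = 0" if "A \<in> J" "P ** A = 0" for A
  proof -
    have "dagger A \<in> K"
      using that JB subB by (simp add: K_def P_dagger star_subspace_dagger)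
    then have "trace (A ** dagger A) = 0" using that by (simp add: J_def)
    then show ?thesis by (simp add: trace_mult_dagger_eq_0_iff)
  qed
  have J_complement: "\<exists>A\<in>J. P ** A = P ** Y" if "Y \<in> B" for Y
  proof
    have "hs_proj K Y \<in> K" by (rule hs_proj_in[OF subK])
    then show "P ** (Y - hs_proj K Y) = P ** Y" by (simp add: mult_diff_right K_def)
    have "hs_proj K Y \<in> B" using \<open>hs_proj K Y \<in> K\<close> by (simp add: K_def)
    then show "Y - hs_proj K Y \<in> J"
      using that subB subK
      by (simp add: J_def star_subspace_diff mult_diff_left trace_sub hs_proj_trace)
  qed
  \<comment> \<open>This says that \<open>P ** A\<close> is the orthogonal projection of
    \<open>M\<close> onto the compressed algebra. In trace form, linearity, adjoints and products of
    lifts all reduce to uniqueness.\<close>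
  define lifts where "lifts M A \<longleftrightarrow> A \<in> J \<and> (\<forall>Y\<in>J. trace (A ** (P ** Y)) = trace (M ** (P ** Y)))" for M A
  have lifts_exist: "\<exists>A. lifts M A" for M
  proof -
    have sub: "star_subspace ((**) P ` J)"
      using PY JB by (intro star_subspace_compression subJ herm) blast
    obtain A where A: "A \<in> J" "hs_proj ((**) P ` J) M = P ** A"
      using hs_proj_in[OF sub, of M] by blast
    have "trace (A ** (P ** Y)) = trace (M ** (P ** Y))" if "Y \<in> J" for Y
    proof -
      have "P ** A ** (P ** Y) = A ** (P ** Y)"
        using A JB by (metis PY idem matrix_mul_assoc)
      then show ?thesis using hs_proj_trace[OF sub, of "P ** Y" M] A that by simp
    qed
    then show ?thesis using A by (auto simp: lifts_def)
  qed
  have lifts_unique: "A = A'" if "lifts M A" "lifts M A'" for M A A'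
  proof -
    have D: "A - A' \<in> J" "dagger (A - A') \<in> J"
      using that subJ by (simp_all add: lifts_def star_subspace_diff star_subspace_dagger)
    then have "trace ((A - A') ** (P ** dagger (A - A'))) = 0"
      using that by (simp add: lifts_def mult_diff_left trace_sub)
    moreover have "(A - A') ** (P ** dagger (A - A')) = P ** (A - A') ** dagger (P ** (A - A'))"
      using D JB by (metis PY P_dagger idem matrix_mul_assoc)
    ultimately have "P ** (A - A') = 0" by (simp add: trace_mult_dagger_eq_0_iff)
    then show ?thesis using J_0 D by fastforce
  qed
  define L0 where "L0 M = (THE A. lifts M A)" for M
  have L0: "lifts M (L0 M)" for M
    unfolding L0_def using lifts_exist lifts_unique by (metis theI)
  have L0_eqI: "L0 M = A" if "lifts M A" for M A using lifts_unique L0 that by blast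
  have L0_J: "L0 M \<in> J" for M using L0 by (simp add: lifts_def)
  have L0_trace: "trace (L0 M ** (P ** Y)) = trace (M ** (P ** Y))" if "Y \<in> B" for M Y
    using J_complement[OF that] L0[of M] unfolding lifts_def by metis
  have lin0: "linear L0"
    using subJ by (intro linearI L0_eqI)
      (simp_all add: lifts_def star_subspaceD L0_J L0_trace JB mult_add_left trace_add
        scaleR_conv_cscale trace_cscale)
  have L0_dagger: "dagger (L0 M) = L0 (dagger M)" for M
  proof (rule L0_eqI[symmetric])
    have "trace (dagger X ** (P ** Y)) = cnj (trace (X ** (P ** dagger Y)))" if "Y \<in> J" for X Y
      by (simp add: trace_dagger[symmetric] P_dagger JB that dagger_mult herm)
        (metis dagger_dagger dagger_mult trace_commute herm PY JB that)
    then show "lifts (dagger M) (dagger (L0 M))"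
      using subJ JB by (simp add: lifts_def star_subspace_dagger L0_J L0_trace)
  qed
  have L0_pos: "positive_op (L0 M)" if M: "positive_op M" for M
  proof (rule ccontr)
    assume "\<not> positive_op (L0 M)"
    moreover have "dagger (L0 M) = L0 M" using L0_dagger M by (simp add: positive_op_self_adjoint)
    ultimately obtain X \<mu> where X: "X \<in> J" "X \<noteq> 0" "\<mu> < 0" "L0 M ** X = cscale (of_real \<mu>) X"
      using negative_eigen_element[OF subJ L0_J[of M]] J_left[OF JB[OF L0_J]] by metis
    \<comment> \<open>Test the trace identity at \<open>X ** dagger X\<close>. On the side of
      \<open>L0 M\<close> it gives \<open>\<mu>\<close> times the squared Hilbert--Schmidt norm of
      \<open>P ** X\<close>, which is nonzero because the compression is injective on
      \<open>J\<close>; on the side of \<open>M\<close> it gives the trace of a congruence of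
      \<open>M\<close>, which is nonnegative.\<close>
    have XX: "X ** dagger X \<in> B"
      using X JB by (simp add: star_algebra_mult[OF B] star_subspace_dagger[OF subB])
    have P_XX: "P ** (X ** dagger X) = (P ** X) ** dagger (P ** X)"
      using X JB by (metis PY P_dagger idem matrix_mul_assoc)
    have "trace (L0 M ** (P ** (X ** dagger X))) = of_real \<mu> * trace (P ** X ** dagger (P ** X))"
    proof -
      have "L0 M ** (P ** (X ** dagger X)) = P ** ((L0 M ** X) ** dagger X)"
        using PY[OF JB[OF L0_J[of M]]] by (simp only: matrix_mul_assoc)
      then show ?thesis by (simp add: X trace_cscale P_XX)
    qed
    moreover have "trace (M ** (P ** (X ** dagger X))) = trace (dagger (P ** X) ** M ** (P ** X))"
      unfolding P_XX by (metis trace_cyclic matrix_mul_assoc)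
    moreover have "trace (P ** X ** dagger (P ** X)) \<noteq> 0"
      using X J_0 by (auto simp: trace_mult_dagger_eq_0_iff)
    moreover have "trace (P ** X ** dagger (P ** X)) \<in> \<real>\<^sub>\<ge>\<^sub>0"
      using positive_op_dagger_mult[of "dagger (P ** X)"] by (simp add: trace_nonneg)
    moreover have "trace (dagger (P ** X) ** M ** (P ** X)) \<in> \<real>\<^sub>\<ge>\<^sub>0"
      by (intro trace_nonneg positive_op_congruence M)
    ultimately show False
      using X(3) L0_trace[OF XX, of M]
      by (auto simp: complex_nonneg_Reals_iff complex_eq_iff mult_less_0_iff zero_le_mult_iff)
  qed
  \<comment> \<open>\<open>z\<close> is the projection in \<open>J\<close> with the same compression
    as \<open>mat 1\<close>; idempotence holds because \<open>z ** z\<close> is also a lift of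
    \<open>mat 1\<close>.\<close>
  define z where "z = L0 (mat 1)"
  have z: "z ** z = z"
    unfolding z_def
  proof (rule L0_eqI[symmetric])
    have "trace (L0 (mat 1) ** L0 (mat 1) ** (P ** Y)) = trace (P ** Y)" if Y: "Y \<in> J" for Y
    proof -
      let ?z = "L0 (mat 1)"
      have zB: "?z \<in> B" using L0_J JB by blast
      have "trace (?z ** ?z ** (P ** Y)) = trace (?z ** (P ** (Y ** ?z)))"
        by (metis matrix_mul_assoc trace_cyclic)
      also have "\<dots> = trace (P ** Y ** ?z)"
        using L0_trace[of "Y ** ?z" "mat 1"] zB Y JB
        by (simp add: star_algebra_mult[OF B] matrix_mul_assoc)
      also have "\<dots> = trace (P ** Y)"
        using L0_trace[of Y "mat 1"] Y JB by (simp add: trace_commute)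
      finally show ?thesis .
    qed
    then show "lifts (mat 1) (L0 (mat 1) ** L0 (mat 1))"
      using J_left L0_J JB by (simp add: lifts_def)
  qed
  have "dagger z = z" by (simp add: z_def L0_dagger)
  then have "mat 1 - z = dagger (mat 1 - z) ** (mat 1 - z)"
    using z by (simp add: dagger_diff mult_diff_left mult_diff_right)
  then have compl_pos: "positive_op (mat 1 - z)" by (metis positive_op_dagger_mult)
  \<comment> \<open>The coefficient is the normalized trace, a positive linear functional with value
    1 at \<open>mat 1\<close>, so the correction preserves linearity and positivity.\<close>
  define L where "L M = L0 M + cscale (trace M / of_nat CARD('i)) (mat 1 - z)" for M
  show thesis
  proof (rule that)
    have "linear (\<lambda>M :: complex^'i^'i. cscale (trace M / of_nat CARD('i)) (mat 1 - z))"
      by (rule linearI)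
        (simp_all add: trace_add add_divide_distrib cmat.scale_left_distrib scaleR_conv_cscale
          trace_cscale)
    then show "linear L" unfolding L_def by (intro linear_compose_add lin0)
    show "L M \<in> B" for M
      using subB one L0_J JB
      by (simp add: L_def z_def star_subspace_add star_subspace_cscale star_subspace_diff)
    show "positive_op (L M)" if "positive_op M" for M
    proof -
      have "trace M / of_nat CARD('i) \<in> \<real>\<^sub>\<ge>\<^sub>0"
        using trace_nonneg[OF that] by (simp add: complex_nonneg_Reals_iff)
      then show ?thesis
        unfolding L_def by (intro positive_op_add positive_op_cscale L0_pos that compl_pos)
    qed
    show "L (mat 1) = mat 1"
      by (simp add: L_def trace_I z_def)
    show "trace (L M ** (P ** Y)) = trace (M ** (P ** Y))" if "Y \<in> B" for M Y
      using L0_trace[OF that]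
      by (simp add: L_def z_def mult_add_left trace_add mult_diff_left trace_sub trace_cscale)
  qed
qed

section \<open>Tensor powers of algebras\<close>

lemma commutant_add: "X \<in> commutant S \<Longrightarrow> Y \<in> commutant S \<Longrightarrow> X + Y \<in> commutant S"
  and commutant_diff: "X \<in> commutant S \<Longrightarrow> Y \<in> commutant S \<Longrightarrow> X - Y \<in> commutant S"
  and commutant_cscale: "X \<in> commutant S \<Longrightarrow> cscale c X \<in> commutant S"
  and commutant_0: "0 \<in> commutant S"
  by (auto simp: commutant_def mult_add_left mult_add_right mult_diff_left mult_diff_right)

lemma commutant_sum: "(\<And>i. i \<in> I \<Longrightarrow> F i \<in> commutant S) \<Longrightarrow> (\<Sum>i\<in>I. F i) \<in> commutant S"
  by (simp add: commutant_def mult_sum_left mult_sum_right)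

lemma commutant_mult:
  assumes "X \<in> commutant S" "Y \<in> commutant S"
  shows "X ** Y \<in> commutant S"
proof (rule commutantI)
  fix A assume "A \<in> S"
  then have "A ** X = X ** A" "A ** Y = Y ** A" using assms by (auto dest: commutantD)
  then show "A ** (X ** Y) = X ** Y ** A" by (metis matrix_mul_assoc)
qed

lemma span_subset_commutant:
  assumes "G \<subseteq> commutant S"
  shows "cmat.span G \<subseteq> commutant S"
proof
  fix X assume "X \<in> cmat.span G"
  then show "X \<in> commutant S"
    by (induction rule: cmat.span_induct_alt)
      (use assms in \<open>auto intro: commutant_0 commutant_add commutant_cscale\<close>)
qed

lemma star_algebra_span:
  assumes dagger: "\<And>A. A \<in> G \<Longrightarrow> dagger A \<in> G"
    and mult: "\<And>A B. A \<in> G \<Longrightarrow> B \<in> G \<Longrightarrow> A ** B \<in> G"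
  shows "star_algebra (cmat.span G)"
proof -
  have "dagger X \<in> cmat.span G" if "X \<in> cmat.span G" for X
    using that
  proof (induction rule: cmat.span_induct_alt)
    case (step c A X)
    then show ?case
      unfolding dagger_add dagger_cscale
      by (auto intro: cmat.span_add cmat.span_scale cmat.span_base dagger)
  qed (simp add: cmat.span_zero)
  moreover have left: "A ** X \<in> cmat.span G" if "A \<in> G" "X \<in> cmat.span G" for A X
    using that(2)
  proof (induction rule: cmat.span_induct_alt)
    case (step c B X)
    then show ?case
      using that(1) unfolding mult_add_right mult_cscale_right
      by (auto intro: cmat.span_add cmat.span_scale cmat.span_base mult)
  qed (simp add: cmat.span_zero)
  have "X ** Y \<in> cmat.span G" if "X \<in> cmat.span G" "Y \<in> cmat.span G" for X Y
    using that(1)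
  proof (induction rule: cmat.span_induct_alt)
    case (step c A X)
    then show ?case
      using that(2) unfolding mult_add_left mult_cscale_left
      by (auto intro: cmat.span_add cmat.span_scale left)
  qed (simp add: cmat.span_zero)
  ultimately show ?thesis
    by (simp add: star_algebra_def star_subspace_def)
qed

lemma star_algebra_Int: "star_algebra S \<Longrightarrow> star_algebra T \<Longrightarrow> star_algebra (S \<inter> T)"
  by (auto simp: star_algebra_def star_subspace_def intro: cmat.subspace_inter)

lemma von_neumann_algebra_iff: "von_neumann_algebra S \<longleftrightarrow> star_algebra S \<and> mat 1 \<in> S"
  by (auto simp: von_neumann_algebra_def star_algebra_def star_subspace_def)

lemma linear_functional_trace:
  fixes f :: "complex^'i^'i \<Rightarrow> complex"
  assumes add: "\<And>X Y. f (X + Y) = f X + f Y" and scale: "\<And>c X. f (cscale c X) = c * f X"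
  shows "\<exists>C. \<forall>X. f X = trace (C ** X)"
proof (intro exI allI)
  have "f 0 = 0" using add[of 0 0] by simp
  then have sum: "f (\<Sum>i\<in>I. F i) = (\<Sum>i\<in>I. f (F i))" for F :: "'i \<Rightarrow> _" and I
    by (induction I rule: infinite_finite_induct) (simp_all add: add)
  fix X
  have "f X = (\<Sum>i\<in>UNIV. \<Sum>j\<in>UNIV. X $ i $ j * f (unit_matrix i j))"
    by (subst matrix_unit_expansion[of X]) (simp add: sum scale)
  also have "\<dots> = (\<Sum>j\<in>UNIV. \<Sum>i\<in>UNIV. X $ i $ j * f (unit_matrix i j))"
    by (rule sum.swap)
  finally show "f X = trace ((\<chi> j i. f (unit_matrix i j)) ** X)"
    by (simp add: trace_def matrix_mult_component mult.commute)
qed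

section \<open>Product operators and operators at a single site\<close>

lemma tensor_ops_component: "tensor_ops A $ i $ j = (\<Prod>k\<in>UNIV. A k $ i k $ j k)"
  by (simp add: tensor_ops_def)

lemma tensor_ops_mult: "tensor_ops A ** tensor_ops B = tensor_ops (\<lambda>k. A k ** B k)"
proof (simp add: vec_eq_iff, intro allI)
  fix i j :: "'a \<Rightarrow> 'b"
  have "(\<Prod>k\<in>UNIV. \<Sum>q\<in>UNIV. A k $ i k $ q * B k $ q $ j k) =
      (\<Sum>m\<in>PiE UNIV (\<lambda>_. UNIV). \<Prod>k\<in>UNIV. A k $ i k $ m k * B k $ m k $ j k)"
    by (rule prod_sum_PiE) auto
  then show "(tensor_ops A ** tensor_ops B) $ i $ j = tensor_ops (\<lambda>k. A k ** B k) $ i $ j"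
    by (simp add: tensor_ops_component matrix_mult_component prod.distrib PiE_UNIV_domain)
qed

lemma tensor_ops_mat_1 [simp]: "tensor_ops (\<lambda>_. mat 1) = mat 1"
proof (simp add: vec_eq_iff, intro allI)
  fix i j :: "'a \<Rightarrow> 'b"
  show "tensor_ops (\<lambda>_. mat 1) $ i $ j = mat 1 $ i $ j"
  proof (cases "i = j")
    case False
    then obtain k where "i k \<noteq> j k" by auto
    then have "(\<Prod>k\<in>UNIV. (mat 1 :: complex^'b^'b) $ i k $ j k) = 0"
      by (intro prod_zero) (auto simp: mat_component)
    then show ?thesis using False by (simp add: tensor_ops_component mat_component)
  qed (simp add: tensor_ops_component mat_component)
qed

lemma dagger_tensor_ops: "dagger (tensor_ops A) = tensor_ops (\<lambda>k. dagger (A k))"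
  by (simp add: vec_eq_iff tensor_ops_component)

lemma tensor_ops_upd:
  "tensor_ops (A(k := X)) $ i $ j = X $ i k $ j k * (\<Prod>l\<in>UNIV - {k}. A l $ i l $ j l)"
  by (simp add: tensor_ops_component prod.remove[of UNIV k])

lemma tensor_ops_upd_add:
  "tensor_ops (A(k := X + Y)) = tensor_ops (A(k := X)) + tensor_ops (A(k := Y))"
  by (simp add: vec_eq_iff tensor_ops_upd distrib_right)

lemma tensor_ops_upd_cscale:
  "tensor_ops (A(k := cscale c X)) = cscale c (tensor_ops (A(k := X)))"
  by (simp add: vec_eq_iff tensor_ops_upd)

definition site_op :: "'n::finite \<Rightarrow> complex^'d^'d \<Rightarrow> complex^('n \<Rightarrow> 'd)^('n \<Rightarrow> 'd)" where
  "site_op k X = tensor_ops ((\<lambda>_. mat 1)(k := X))"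

lemma site_op_mult: "site_op k X ** tensor_ops A = tensor_ops (A(k := X ** A k))"
  and mult_site_op: "tensor_ops A ** site_op k X = tensor_ops (A(k := A k ** X))"
  unfolding site_op_def tensor_ops_mult
  by (rule arg_cong[where f = tensor_ops], auto)+

lemma star_algebra_tensor_power:
  assumes "star_algebra S"
  shows "star_algebra (algebra_tensor_power S)"
  unfolding algebra_tensor_power_def
  by (rule star_algebra_span)
    (use assms in \<open>auto simp: tensor_ops_mult dagger_tensor_ops star_algebra_mult
      star_subspace_dagger star_algebra_imp_subspace\<close>)

text \<open>In the trace against an operator commuting with \<open>\<A>'\<close> at each site, every factor of a product operator
  can be replaced by its projection to \<open>\<A>'' = \<A>\<close>.\<close>

theorem tensor_commutation:
  fixes Z :: "complex^('n::finite \<Rightarrow> 'd::finite)^('n \<Rightarrow> 'd)"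
  assumes \<A>: "von_neumann_algebra \<A>"
    and Z: "\<And>k W. W \<in> commutant \<A> \<Longrightarrow> site_op k W ** Z = Z ** site_op k W"
  shows "Z \<in> algebra_tensor_power \<A>"
proof -
  have alg: "star_algebra \<A>" "mat 1 \<in> \<A>" using \<A> by (simp_all add: von_neumann_algebra_iff)
  note sub = star_algebra_imp_subspace[OF alg(1)]
  let ?S = "algebra_tensor_power \<A> :: (complex^('n \<Rightarrow> 'd)^('n \<Rightarrow> 'd)) set"
  have subS: "star_subspace ?S"
    by (intro star_algebra_imp_subspace star_algebra_tensor_power alg)
  let ?C = "{site_op k W | k W. W \<in> commutant \<A>}"
  \<comment> \<open>The part of \<open>Z\<close> orthogonal to the tensor power of
    \<open>\<A>\<close>; the aim is to show that it is zero.\<close>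
  define Z' where "Z' = Z - hs_proj ?S Z"
  have "?S \<subseteq> commutant ?C"
    unfolding algebra_tensor_power_def
  proof (rule span_subset_commutant, safe)
    fix A :: "'n \<Rightarrow> complex^'d^'d" assume "\<forall>k. A k \<in> \<A>"
    then have "A k ** W = W ** A k" if "W \<in> commutant \<A>" for k W
      using that by (blast dest: commutantD)
    then show "tensor_ops A \<in> commutant ?C"
      by (intro commutantI) (auto simp: site_op_mult mult_site_op)
  qed
  then have "hs_proj ?S Z \<in> commutant ?C" using hs_proj_in[OF subS] by blast
  moreover have "Z \<in> commutant ?C" using Z by (auto intro: commutantI)
  ultimately have "Z' \<in> commutant ?C" unfolding Z'_def by (rule commutant_diff[rotated])
  then have Z'_comm: "site_op k W ** Z' = Z' ** site_op k W" if "W \<in> commutant \<A>" for k W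
    using that by (auto dest: commutantD)
  have replace: "trace (Z' ** tensor_ops (x(k := hs_proj \<A> X))) = trace (Z' ** tensor_ops (x(k := X)))"
    for x k X
  proof -
    \<comment> \<open>With the other factors frozen, the trace is a linear functional of factor
      \<open>k\<close>, hence given by a matrix \<open>C\<close>. Commutation at site
      \<open>k\<close> makes \<open>C\<close> commute with the commutant of \<open>\<A>\<close>, so
      \<open>C\<close> lies in \<open>\<A>\<close> and cannot distinguish \<open>X\<close> from its
      projection.\<close>
    define f where "f Y = trace (Z' ** tensor_ops (x(k := Y)))" for Y
    have "\<exists>C. \<forall>Y. f Y = trace (C ** Y)"
    proof (rule linear_functional_trace)
      show "f (X + Y) = f X + f Y" for X Y
        by (simp add: f_def tensor_ops_upd_add mult_add_right trace_add)
      show "f (cscale c X) = c * f X" for c X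
        by (simp add: f_def tensor_ops_upd_cscale trace_cscale)
    qed
    then obtain C where C: "\<And>Y. f Y = trace (C ** Y)" by blast
    have "C \<in> commutant (commutant \<A>)"
    proof (rule commutantI)
      fix W assume W: "W \<in> commutant \<A>"
      have "f (W ** Y) = f (Y ** W)" for Y
      proof -
        have "f (W ** Y) = trace (Z' ** site_op k W ** tensor_ops (x(k := Y)))"
          by (simp add: f_def site_op_mult matrix_mul_assoc[symmetric])
        also have "\<dots> = trace (site_op k W ** Z' ** tensor_ops (x(k := Y)))"
          by (simp add: Z'_comm[OF W])
        also have "\<dots> = trace (Z' ** tensor_ops (x(k := Y)) ** site_op k W)"
          by (rule trace_cyclic[symmetric])
        also have "\<dots> = f (Y ** W)"
          by (simp add: f_def mult_site_op matrix_mul_assoc[symmetric])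
        finally show ?thesis .
      qed
      then have "trace (C ** W ** Y) = trace (W ** C ** Y)" for Y
        using trace_cyclic[of C Y W] by (simp add: C matrix_mul_assoc)
      then have "W ** C - C ** W = 0"
        by (intro trace_mult_eq_0_imp_eq_0) (simp add: mult_diff_left trace_sub)
      then show "W ** C = C ** W" by simp
    qed
    then have "C \<in> \<A>" using alg by (rule double_commutant[OF _ _ matrix_mul_rid, rotated 2])
    then have "f (hs_proj \<A> X) = f X"
      using hs_proj_trace[OF sub] by (simp add: C trace_commute[of C])
    then show ?thesis by (simp add: f_def)
  qed
  have "trace (Z' ** tensor_ops (\<lambda>k. if k \<in> F then hs_proj \<A> (x k) else x k)) = trace (Z' ** tensor_ops x)"
    if "finite F" for F x
    using that
  proof (induction F)
    case (insert k F)
    let ?y = "\<lambda>k. if k \<in> F then hs_proj \<A> (x k) else x k"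
    have "(\<lambda>l. if l \<in> insert k F then hs_proj \<A> (x l) else x l) = ?y(k := hs_proj \<A> (x k))"
      by auto
    moreover have "?y(k := x k) = ?y" using insert.hyps by auto
    ultimately show ?case using insert.IH replace[of ?y k "x k"] by (simp only:)
  qed simp
  from this[OF finite_class.finite_UNIV]
  have all: "trace (Z' ** tensor_ops (\<lambda>k. hs_proj \<A> (x k))) = trace (Z' ** tensor_ops x)" for x
    by simp
  have "trace (Z' ** tensor_ops x) = 0" for x
  proof -
    have "tensor_ops (\<lambda>k. hs_proj \<A> (x k)) \<in> ?S"
      unfolding algebra_tensor_power_def
      using hs_proj_in[OF sub] by (intro cmat.span_base) auto
    then have "trace (Z' ** tensor_ops (\<lambda>k. hs_proj \<A> (x k))) = 0"
      by (simp add: Z'_def mult_diff_left trace_sub hs_proj_trace[OF subS])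
    then show ?thesis by (simp add: all)
  qed
  \<comment> \<open>Matrix units of the tensor power are product operators, so orthogonality to
    products is orthogonality to everything.\<close>
  moreover have "unit_matrix i j = tensor_ops (\<lambda>k. unit_matrix (i k) (j k))" for i j :: "'n \<Rightarrow> 'd"
  proof (simp add: vec_eq_iff tensor_ops_component, intro allI)
    fix a b :: "'n \<Rightarrow> 'd"
    show "unit_matrix i j $ a $ b = (\<Prod>k\<in>UNIV. unit_matrix (i k) (j k) $ a k $ b k)"
    proof (cases "a = i \<and> b = j")
      case False
      then obtain k where "\<not> (a k = i k \<and> b k = j k)" by auto
      then have "(\<Prod>k\<in>UNIV. unit_matrix (i k) (j k) $ a k $ b k) = 0"
        by (intro prod_zero) (auto simp: unit_matrix_def)
      then show ?thesis using False by (auto simp: unit_matrix_def)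
    qed (simp add: unit_matrix_def)
  qed
  ultimately have "trace (Z' ** Y) = 0" for Y
    by (subst matrix_unit_expansion[of Y]) (simp add: mult_sum_right trace_sum trace_cscale)
  then have "Z' = 0" by (rule trace_mult_eq_0_imp_eq_0)
  then show ?thesis using hs_proj_in[OF subS, of Z] by (simp add: Z'_def)
qed

section \<open>Permutations of the tensor factors\<close>

text \<open>On basis tensors this is \<open>e j \<mapsto> e (j \<circ> \<pi>)\<close>;
  precomposition reverses the order of products.\<close>

definition perm_op :: "('n::finite \<Rightarrow> 'n) \<Rightarrow> complex^('n \<Rightarrow> 'd::finite)^('n \<Rightarrow> 'd)" where
  "perm_op \<pi> = (\<chi> i j. if i = j \<circ> \<pi> then 1 else 0)"

lemma perm_op_mult: "perm_op \<pi> ** perm_op \<tau> = perm_op (\<tau> \<circ> \<pi>)"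
  by (simp add: vec_eq_iff matrix_mult_component perm_op_def if_distrib[of "\<lambda>x. _ * x"]
      comp_assoc cong: if_cong)

lemma perm_op_id [simp]: "perm_op id = mat 1"
  by (simp add: vec_eq_iff perm_op_def mat_component)

lemma dagger_perm_op:
  assumes "bij \<pi>"
  shows "dagger (perm_op \<pi>) = perm_op (inv \<pi>)"
proof -
  have "i = j \<circ> inv \<pi> \<longleftrightarrow> j = i \<circ> \<pi>" for i j :: "'a \<Rightarrow> 'b"
    using assms by (auto simp: fun_eq_iff bij_is_surj surj_f_inv_f bij_is_inj)
  then show ?thesis by (simp add: vec_eq_iff perm_op_def)
qed

lemma perm_op_tensor_ops:
  assumes "bij \<pi>"
  shows "perm_op \<pi> ** tensor_ops A = tensor_ops (A \<circ> \<pi>) ** perm_op \<pi>"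
proof (simp add: vec_eq_iff, intro allI)
  fix i j :: "'a \<Rightarrow> 'b"
  have eq: "i = m \<circ> \<pi> \<longleftrightarrow> m = i \<circ> inv \<pi>" for m
    using assms by (auto simp: fun_eq_iff bij_is_surj surj_f_inv_f bij_is_inj)
  have "(perm_op \<pi> ** tensor_ops A) $ i $ j = (\<Prod>k\<in>UNIV. A k $ i (inv \<pi> k) $ j k)"
    by (simp add: matrix_mult_component perm_op_def eq tensor_ops_component
        if_distrib[of "\<lambda>x. x * _"] cong: if_cong)
  also have "\<dots> = (\<Prod>k\<in>UNIV. A (\<pi> k) $ i (inv \<pi> (\<pi> k)) $ j (\<pi> k))"
    using assms by (rule prod.reindex_bij_betw[symmetric])
  also have "\<dots> = (tensor_ops (A \<circ> \<pi>) ** perm_op \<pi>) $ i $ j"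
    using assms by (simp add: matrix_mult_component perm_op_def tensor_ops_component
        if_distrib[of "\<lambda>x. _ * x"] bij_is_inj cong: if_cong)
  finally show "(perm_op \<pi> ** tensor_ops A) $ i $ j = (tensor_ops (A \<circ> \<pi>) ** perm_op \<pi>) $ i $ j" .
qed

definition symmetric_algebra :: "(complex^'d^'d) set \<Rightarrow> (complex^('n::finite \<Rightarrow> 'd::finite)^('n \<Rightarrow> 'd)) set" where
  "symmetric_algebra \<A> = algebra_tensor_power \<A> \<inter> commutant (perm_op ` {\<pi>. bij \<pi>})"

lemma star_algebra_symmetric_algebra:
  assumes "star_algebra \<A>"
  shows "star_algebra (symmetric_algebra \<A>)"
  unfolding symmetric_algebra_def
  by (intro star_algebra_Int star_algebra_tensor_power assms star_algebra_commutant)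
    (auto simp: dagger_perm_op bij_imp_bij_inv)

lemma mat_1_in_symmetric_algebra:
  assumes "mat 1 \<in> \<A>"
  shows "mat 1 \<in> symmetric_algebra \<A>"
proof -
  have "tensor_ops (\<lambda>_. mat 1) \<in> algebra_tensor_power \<A>"
    unfolding algebra_tensor_power_def by (rule cmat.span_base) (use assms in blast)
  then show ?thesis by (simp add: symmetric_algebra_def)
qed

text \<open>The span is a unital star algebra, since a permutation moves past a product operator by
  rearranging its factors. Whatever commutes with it lies in \<open>symmetric_algebra \<A>\<close>:
  the generators acting at one site give membership in the tensor power by
  \<open>tensor_commutation\<close>, and the pure permutations give invariance. Hence
  \<open>Y\<close> is in the double commutant of the span.\<close>

lemma commutant_symmetric_algebra:
  fixes Y :: "complex^('n::finite \<Rightarrow> 'd::finite)^('n \<Rightarrow> 'd)"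
  assumes \<A>: "von_neumann_algebra \<A>" and Y: "Y \<in> commutant (symmetric_algebra \<A>)"
  shows "Y \<in> cmat.span {tensor_ops W ** perm_op \<pi> | W \<pi>. (\<forall>k. W k \<in> commutant \<A>) \<and> bij \<pi>}"
    (is "Y \<in> cmat.span ?G")
proof -
  have C: "star_algebra (commutant \<A>)"
    using \<A> by (intro star_algebra_commutant) (simp add: von_neumann_algebra_def)
  have G: "tensor_ops W ** perm_op \<pi> \<in> ?G" if "\<And>k. W k \<in> commutant \<A>" "bij \<pi>" for W \<pi>
    using that by blast
  have "star_algebra (cmat.span ?G)"
  proof (rule star_algebra_span)
    fix X assume "X \<in> ?G"
    then obtain W \<pi> where X: "X = tensor_ops W ** perm_op \<pi>"
      and W: "\<forall>k. W k \<in> commutant \<A>" and \<pi>: "bij \<pi>" by blast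
    have "dagger (tensor_ops W ** perm_op \<pi>) = tensor_ops ((\<lambda>k. dagger (W k)) \<circ> inv \<pi>) ** perm_op (inv \<pi>)"
      using \<pi> by (simp add: dagger_mult dagger_perm_op dagger_tensor_ops perm_op_tensor_ops bij_imp_bij_inv)
    moreover have "\<dots> \<in> ?G"
      using W \<pi> by (intro G)
        (simp_all add: bij_imp_bij_inv star_subspace_dagger star_algebra_imp_subspace C)
    ultimately show "dagger X \<in> ?G" by (simp only: X)
    fix X' assume "X' \<in> ?G"
    then obtain W' \<pi>' where X': "X' = tensor_ops W' ** perm_op \<pi>'"
      and W': "\<forall>k. W' k \<in> commutant \<A>" and \<pi>': "bij \<pi>'" by blast
    have "tensor_ops W ** perm_op \<pi> ** (tensor_ops W' ** perm_op \<pi>') =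
        tensor_ops W ** (perm_op \<pi> ** tensor_ops W') ** perm_op \<pi>'"
      by (simp add: matrix_mul_assoc)
    also have "\<dots> = tensor_ops W ** tensor_ops (W' \<circ> \<pi>) ** (perm_op \<pi> ** perm_op \<pi>')"
      using \<pi> by (simp add: perm_op_tensor_ops matrix_mul_assoc)
    also have "\<dots> = tensor_ops (\<lambda>k. W k ** (W' \<circ> \<pi>) k) ** perm_op (\<pi>' \<circ> \<pi>)"
      by (simp add: tensor_ops_mult perm_op_mult)
    also have "\<dots> \<in> ?G"
      using W W' \<pi> \<pi>' by (intro G bij_comp star_algebra_mult[OF C]) auto
    finally show "X ** X' \<in> ?G" by (simp only: X X')
  qed
  moreover have "mat 1 \<in> cmat.span ?G"
    using G[of "\<lambda>_. mat 1" id] by (simp add: cmat.span_base)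
  moreover have "Y \<in> commutant (commutant (cmat.span ?G))"
  proof (rule commutantI)
    fix Z assume Z: "Z \<in> commutant (cmat.span ?G)"
    then have comm: "X ** Z = Z ** X" if "X \<in> ?G" for X
      using that by (auto intro!: commutantD cmat.span_base)
    have "Z \<in> algebra_tensor_power \<A>"
    proof (rule tensor_commutation[OF \<A>])
      show "site_op k W ** Z = Z ** site_op k W" if "W \<in> commutant \<A>" for k W
        using comm[OF G[of "(\<lambda>_. mat 1)(k := W)" id]] that by (simp add: site_op_def)
    qed
    moreover have "perm_op \<pi> ** Z = Z ** perm_op \<pi>" if "bij \<pi>" for \<pi>
      using comm[OF G[of "\<lambda>_. mat 1" \<pi>]] that by simp
    ultimately have "Z \<in> symmetric_algebra \<A>"
      by (auto simp: symmetric_algebra_def intro: commutantI)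
    then show "Z ** Y = Y ** Z" using Y by (simp add: commutantD)
  qed
  ultimately show ?thesis by (rule double_commutant[OF _ _ matrix_mul_rid])
qed

section \<open>The symmetric subspace\<close>

lemma bij_betw_comp_right:
  fixes \<tau> :: "'n \<Rightarrow> 'n"
  assumes "bij \<tau>"
  shows "bij_betw (\<lambda>\<pi>. \<pi> \<circ> \<tau>) {\<pi>. bij \<pi>} {\<pi>. bij \<pi>}"
proof (rule bij_betw_byWitness[where f' = "\<lambda>\<pi>. \<pi> \<circ> inv \<tau>"])
  have "inv \<tau> \<circ> \<tau> = id" "\<tau> \<circ> inv \<tau> = id"
    using assms by (simp_all add: bij_is_inj surj_iff[THEN iffD1] bij_is_surj)
  then show "\<forall>\<pi>\<in>{\<pi>. bij \<pi>}. (\<pi> \<circ> \<tau>) \<circ> inv \<tau> = \<pi>" "\<forall>\<pi>\<in>{\<pi>. bij \<pi>}. (\<pi> \<circ> inv \<tau>) \<circ> \<tau> = \<pi>"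
    by (simp_all add: comp_assoc)
qed (use assms in \<open>auto intro: bij_comp bij_imp_bij_inv\<close>)

lemma bij_betw_comp_left:
  fixes \<tau> :: "'n \<Rightarrow> 'n"
  assumes "bij \<tau>"
  shows "bij_betw (\<lambda>\<pi>. \<tau> \<circ> \<pi>) {\<pi>. bij \<pi>} {\<pi>. bij \<pi>}"
proof (rule bij_betw_byWitness[where f' = "\<lambda>\<pi>. inv \<tau> \<circ> \<pi>"])
  have "inv \<tau> \<circ> \<tau> = id" "\<tau> \<circ> inv \<tau> = id"
    using assms by (simp_all add: bij_is_inj surj_iff[THEN iffD1] bij_is_surj)
  then show "\<forall>\<pi>\<in>{\<pi>. bij \<pi>}. inv \<tau> \<circ> (\<tau> \<circ> \<pi>) = \<pi>" "\<forall>\<pi>\<in>{\<pi>. bij \<pi>}. \<tau> \<circ> (inv \<tau> \<circ> \<pi>) = \<pi>"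
    by (simp_all add: comp_assoc[symmetric])
qed (use assms in \<open>auto intro: bij_comp bij_imp_bij_inv\<close>)

lemma bij_betw_inv: "bij_betw inv {\<pi> :: 'n \<Rightarrow> 'n. bij \<pi>} {\<pi>. bij \<pi>}"
  by (rule bij_betw_byWitness[where f' = inv]) (auto simp: inv_inv_eq bij_imp_bij_inv)

definition sym_proj :: "complex^('n::finite \<Rightarrow> 'd::finite)^('n \<Rightarrow> 'd)" where
  "sym_proj = cscale (1 / of_nat (card {\<pi> :: 'n \<Rightarrow> 'n. bij \<pi>})) (\<Sum>\<pi> | bij \<pi>. perm_op \<pi>)"

lemma card_bij_nonzero: "card {\<pi> :: 'n::finite \<Rightarrow> 'n. bij \<pi>} \<noteq> 0"
  using bij_id by (auto simp: card_eq_0_iff)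

lemma sum_const_cscale: "(\<Sum>x\<in>S. X) = cscale (of_nat (card S)) X"
  by (induction S rule: infinite_finite_induct)
    (simp_all del: sum_constant add: vec_eq_iff algebra_simps)

lemma perm_op_sym_proj:
  fixes \<tau> :: "'n::finite \<Rightarrow> 'n"
  assumes "bij \<tau>"
  shows "perm_op \<tau> ** sym_proj = (sym_proj :: complex^('n \<Rightarrow> 'd::finite)^('n \<Rightarrow> 'd))"
proof -
  have "(\<Sum>\<pi> | bij \<pi>. perm_op \<tau> ** perm_op \<pi>) =
      (\<Sum>\<pi> | bij \<pi>. perm_op \<pi> :: complex^('n \<Rightarrow> 'd)^('n \<Rightarrow> 'd))"
    unfolding perm_op_mult using bij_betw_comp_right[OF assms] by (rule sum.reindex_bij_betw)
  then show ?thesis by (simp add: sym_proj_def mult_sum_right)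
qed

lemma dagger_sym_proj: "dagger sym_proj = (sym_proj :: complex^('n::finite \<Rightarrow> 'd::finite)^('n \<Rightarrow> 'd))"
proof -
  have "(\<Sum>\<pi> | bij \<pi>. dagger (perm_op \<pi> :: complex^('n \<Rightarrow> 'd)^('n \<Rightarrow> 'd))) =
      (\<Sum>\<pi> | bij \<pi>. perm_op (inv \<pi>))"
    by (simp add: dagger_perm_op)
  also have "\<dots> = (\<Sum>\<pi> | bij \<pi>. perm_op \<pi>)"
    using bij_betw_inv by (rule sum.reindex_bij_betw)
  finally show ?thesis by (simp add: sym_proj_def dagger_cscale dagger_sum)
qed

lemma sym_proj_mult_eqI:
  fixes X :: "complex^('n::finite \<Rightarrow> 'd::finite)^('n \<Rightarrow> 'd)"
  assumes "\<And>\<tau>. bij \<tau> \<Longrightarrow> perm_op \<tau> ** X = X"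
  shows "sym_proj ** X = X"
proof -
  have "(\<Sum>\<pi> | bij \<pi>. perm_op \<pi> ** X) = (\<Sum>\<pi> :: 'n \<Rightarrow> 'n | bij \<pi>. X)"
    by (rule sum.cong) (simp_all add: assms)
  then show ?thesis
    using card_bij_nonzero[where 'n='n]
    by (auto simp: sym_proj_def mult_sum_left sum_const_cscale simp del: sum_constant)
qed

lemma sym_proj_idem: "sym_proj ** sym_proj = sym_proj"
  by (rule sym_proj_mult_eqI) (rule perm_op_sym_proj)

lemma sym_proj_idem_left: "sym_proj ** (sym_proj ** X) = sym_proj ** X"
  by (simp add: matrix_mul_assoc sym_proj_idem)

lemma sym_proj_perm_op:
  assumes "bij \<tau>"
  shows "sym_proj ** perm_op \<tau> = sym_proj"
proof -
  have "dagger (perm_op (inv \<tau>) ** sym_proj) = dagger sym_proj"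
    using assms by (simp add: perm_op_sym_proj bij_imp_bij_inv)
  then show ?thesis
    using assms by (simp add: dagger_mult dagger_sym_proj dagger_perm_op bij_imp_bij_inv inv_inv_eq)
qed

lemma sym_proj_in_commutant:
  "S \<subseteq> commutant (perm_op ` {\<pi>. bij \<pi>}) \<Longrightarrow> sym_proj \<in> commutant S"
  by (rule commutantI) (auto simp: sym_proj_def mult_sum_left mult_sum_right commutant_def
      intro!: arg_cong[where f = "cscale _"] sum.cong)

definition sym_tensor :: "('n::finite \<Rightarrow> complex^'d^'d) \<Rightarrow> complex^('n \<Rightarrow> 'd::finite)^('n \<Rightarrow> 'd)" where
  "sym_tensor W = (\<Sum>\<pi> | bij \<pi>. tensor_ops (W \<circ> \<pi>))"

lemma sym_tensor_comp: "bij \<tau> \<Longrightarrow> sym_tensor (W \<circ> \<tau>) = sym_tensor W"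
  unfolding sym_tensor_def comp_assoc
  by (rule sum.reindex_bij_betw[OF bij_betw_comp_left])

text \<open>\<open>sym_proj\<close> absorbs permutations on both sides, so all rearrangements of
  \<open>W\<close> have the same compression, and \<open>sym_tensor W\<close> adds up one copy for
  each bijection.\<close>

lemma sym_tensor_compression:
  fixes W :: "'n::finite \<Rightarrow> complex^'d::finite^'d"
  shows "sym_proj ** tensor_ops W ** sym_proj =
    cscale (1 / of_nat (card {\<pi> :: 'n \<Rightarrow> 'n. bij \<pi>})) (sym_proj ** sym_tensor W)"
proof -
  have "perm_op \<tau> ** sym_tensor W = sym_tensor W ** perm_op \<tau>" if "bij \<tau>" for \<tau>
  proof -
    have "perm_op \<tau> ** sym_tensor W = (\<Sum>\<pi> | bij \<pi>. tensor_ops (W \<circ> (\<pi> \<circ> \<tau>))) ** perm_op \<tau>"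
      using that by (simp add: sym_tensor_def mult_sum_left mult_sum_right perm_op_tensor_ops comp_assoc)
    also have "(\<Sum>\<pi> | bij \<pi>. tensor_ops (W \<circ> (\<pi> \<circ> \<tau>))) = sym_tensor W"
      unfolding sym_tensor_def using bij_betw_comp_right[OF that] by (rule sum.reindex_bij_betw)
    finally show ?thesis .
  qed
  then have "{sym_tensor W} \<subseteq> commutant (perm_op ` {\<pi>. bij \<pi>})"
    by (auto intro!: commutantI)
  then have comm: "sym_tensor W ** sym_proj = sym_proj ** sym_tensor W"
    using sym_proj_in_commutant commutantD by blast
  have *: "sym_proj ** tensor_ops (W \<circ> \<pi>) ** sym_proj = sym_proj ** tensor_ops W ** sym_proj"
    if "bij \<pi>" for \<pi>
  proof -
    have "sym_proj ** tensor_ops (W \<circ> \<pi>) ** sym_proj = sym_proj ** (tensor_ops (W \<circ> \<pi>) ** perm_op \<pi>) ** sym_proj"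
      using that by (simp add: perm_op_sym_proj matrix_mul_assoc[symmetric])
    also have "\<dots> = sym_proj ** perm_op \<pi> ** tensor_ops W ** sym_proj"
      using that by (simp add: perm_op_tensor_ops[symmetric] matrix_mul_assoc)
    finally show ?thesis using that by (simp add: sym_proj_perm_op)
  qed
  have "sym_proj ** sym_tensor W = sym_proj ** (sym_proj ** sym_tensor W)"
    by (simp add: matrix_mul_assoc sym_proj_idem)
  also have "\<dots> = sym_proj ** sym_tensor W ** sym_proj"
    by (simp add: comm[symmetric] matrix_mul_assoc)
  also have "\<dots> = (\<Sum>\<pi> :: 'n \<Rightarrow> 'n | bij \<pi>. sym_proj ** tensor_ops W ** sym_proj)"
    unfolding sym_tensor_def mult_sum_right mult_sum_left by (rule sum.cong) (simp_all add: *)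
  finally show ?thesis
    using card_bij_nonzero[where 'n='n] by (auto simp: sum_const_cscale simp del: sum_constant)
qed

text \<open>Compressing by \<open>P = sym_proj\<close>, the commutant of \<open>P (symmetric_algebra \<A>)\<close> becomes a compression of the
  commutant of \<open>symmetric_algebra \<A>\<close>, hence is spanned by the operators \<open>P (sym_tensor W)\<close>, with which \<open>\<sigma>\<close>
  commutes; the double commutant theorem applies.\<close>

theorem symmetric_duality:
  fixes \<sigma> :: "complex^('n::finite \<Rightarrow> 'd::finite)^('n \<Rightarrow> 'd)"
  assumes \<A>: "von_neumann_algebra \<A>"
    and left: "sym_proj ** \<sigma> = \<sigma>" and right: "\<sigma> ** sym_proj = \<sigma>"
    and comm: "\<And>W. (\<And>k. W k \<in> commutant \<A>) \<Longrightarrow> sym_tensor W ** \<sigma> = \<sigma> ** sym_tensor W"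
  shows "\<exists>Y \<in> symmetric_algebra \<A>. \<sigma> = sym_proj ** Y"
proof -
  let ?B = "symmetric_algebra \<A> :: (complex^('n \<Rightarrow> 'd)^('n \<Rightarrow> 'd)) set"
  let ?P = "sym_proj :: complex^('n \<Rightarrow> 'd)^('n \<Rightarrow> 'd)"
  let ?M = "(**) ?P ` ?B"
  have B: "star_algebra ?B" "mat 1 \<in> ?B"
    using \<A> by (simp_all add: von_neumann_algebra_iff star_algebra_symmetric_algebra mat_1_in_symmetric_algebra)
  have "?P \<in> commutant ?B"
    by (rule sym_proj_in_commutant) (simp add: symmetric_algebra_def)
  then have PB: "Y ** ?P = ?P ** Y" if "Y \<in> ?B" for Y using that by (rule commutantD)
  have M: "star_algebra ?M"
    unfolding star_algebra_def
  proof (intro conjI ballI)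
    show "star_subspace ?M"
      by (intro star_subspace_compression star_algebra_imp_subspace B dagger_sym_proj PB)
    fix X X' assume "X \<in> ?M" "X' \<in> ?M"
    then obtain Y Y' where Y: "X = ?P ** Y" "Y \<in> ?B" "X' = ?P ** Y'" "Y' \<in> ?B" by blast
    have "X ** X' = ?P ** (Y ** ?P) ** Y'" by (simp add: Y matrix_mul_assoc)
    also have "\<dots> = ?P ** (Y ** Y')" by (simp add: PB Y matrix_mul_assoc sym_proj_idem)
    finally show "X ** X' \<in> ?M" using Y B by (auto intro!: imageI star_algebra_mult)
  qed
  have P_in: "?P \<in> ?M" using B(2) by (auto intro: image_eqI[of _ _ "mat 1"])
  have "\<sigma> \<in> commutant (commutant ?M)"
  proof (rule commutantI)
    fix X assume X: "X \<in> commutant ?M"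
    have PX: "?P ** X = X ** ?P" using commutantD[OF X P_in] .
    \<comment> \<open>Since \<sigma> is supported on the symmetric subspace and \<open>X\<close>
      commutes with \<open>?P\<close>, only the compression \<open>Y\<close> of \<open>X\<close>
      matters for \<sigma>. Unlike \<open>X\<close> itself, \<open>Y\<close> commutes with all of
      \<open>?B\<close>.\<close>
    define Y where "Y = ?P ** X ** ?P"
    have "Y \<in> commutant ?B"
    proof (rule commutantI)
      fix b assume b: "b \<in> ?B"
      then have "?P ** b ** X = X ** (?P ** b)" using commutantD[OF X] by blast
      moreover have "b ** Y = ?P ** b ** X ** ?P"
        using PB[OF b] by (simp add: Y_def matrix_mul_assoc)
      moreover have "Y ** b = X ** (?P ** b)"
        by (simp add: Y_def PX matrix_mul_assoc[symmetric] sym_proj_idem_left)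
      moreover have "X ** (?P ** b) ** ?P = X ** (?P ** b)"
        using PB[OF b] by (metis matrix_mul_assoc sym_proj_idem)
      ultimately show "b ** Y = Y ** b" by simp
    qed
    then have "Y \<in> cmat.span {tensor_ops W ** perm_op \<pi> | W \<pi>. (\<forall>k. W k \<in> commutant \<A>) \<and> bij \<pi>}"
      by (rule commutant_symmetric_algebra[OF \<A>])
    then have "?P ** Y ** ?P ** \<sigma> = \<sigma> ** (?P ** Y ** ?P)"
    proof (induction rule: cmat.span_induct_alt)
      case (step c G Z)
      then obtain W \<pi> where G: "G = tensor_ops W ** perm_op \<pi>" and W: "\<And>k. W k \<in> commutant \<A>" and "bij \<pi>"
        by blast
      \<comment> \<open>The permutation is absorbed by \<open>?P\<close>, which turns the generator
        into a symmetrized product, and \<sigma> commutes with that by assumption.\<close>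
      have "?P ** G ** ?P = ?P ** tensor_ops W ** ?P"
        using \<open>bij \<pi>\<close> by (simp add: G perm_op_sym_proj matrix_mul_assoc[symmetric])
      also have "\<dots> = cscale (1 / of_nat (card {\<pi> :: 'n \<Rightarrow> 'n. bij \<pi>})) (?P ** sym_tensor W)"
        by (rule sym_tensor_compression)
      finally have PGP: "?P ** G ** ?P = \<dots>" .
      have "?P ** sym_tensor W ** \<sigma> = ?P ** \<sigma> ** sym_tensor W"
        using comm[OF W] by (simp add: matrix_mul_assoc[symmetric])
      then have "?P ** sym_tensor W ** \<sigma> = \<sigma> ** (?P ** sym_tensor W)"
        by (simp add: left right matrix_mul_assoc)
      then have "?P ** G ** ?P ** \<sigma> = \<sigma> ** (?P ** G ** ?P)"
        by (simp add: PGP)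
      then show ?case
        using step.IH by (simp add: mult_add_left mult_add_right)
    qed simp
    moreover have "?P ** Y ** ?P = Y"
      by (simp add: Y_def matrix_mul_assoc sym_proj_idem)
        (simp add: matrix_mul_assoc[symmetric] sym_proj_idem)
    moreover have "Y ** \<sigma> = X ** \<sigma>"
      by (simp add: Y_def PX matrix_mul_assoc[symmetric] left sym_proj_idem)
    moreover have "\<sigma> ** Y = \<sigma> ** X"
      by (simp add: Y_def PX[symmetric] matrix_mul_assoc[symmetric])
        (simp add: matrix_mul_assoc sym_proj_idem right)
    ultimately show "X ** \<sigma> = \<sigma> ** X" by simp
  qed
  \<comment> \<open>The unit of \<open>?M\<close> is \<open>?P\<close>, so the double commutant
    theorem is applied with \<open>e = ?P\<close>; the condition on \<open>e\<close> is then
    \<open>right\<close>.\<close>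
  then have "\<sigma> \<in> ?M" by (rule double_commutant[OF M P_in right])
  then show ?thesis by blast
qed

section \<open>The collective action of the gauge group\<close>

text \<open>The infinitesimal collective action: the derivative at \<open>t = 0\<close> of the
  tensor power of \<open>mat 1 + t *\<^sub>R X\<close>.\<close>

definition site_sum :: "complex^'d^'d \<Rightarrow> complex^('n::finite \<Rightarrow> 'd::finite)^('n \<Rightarrow> 'd)" where
  "site_sum X = (\<Sum>k\<in>UNIV. site_op k X)"

text \<open>Each summand of the site sum multiplies one factor by \<open>V\<close>. Within the term
  of \<open>\<pi>\<close>, site \<open>l\<close> carries \<open>W (\<pi> l)\<close>, and reindexing
  by \<open>\<pi>\<close> makes the modified index independent of the rearrangement.\<close>

lemma site_sum_sym_tensor:
  fixes W :: "'n::finite \<Rightarrow> complex^'d::finite^'d"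
  shows "site_sum V ** sym_tensor W = (\<Sum>k\<in>UNIV. sym_tensor (W(k := V ** W k)))"
proof -
  have "site_sum V ** sym_tensor W = (\<Sum>\<pi> | bij \<pi>. \<Sum>l\<in>UNIV. site_op l V ** tensor_ops (W \<circ> \<pi>))"
    by (simp add: site_sum_def sym_tensor_def mult_sum_left mult_sum_right)
  also have "\<dots> = (\<Sum>\<pi> | bij \<pi>. \<Sum>k\<in>UNIV. tensor_ops (W(k := V ** W k) \<circ> \<pi>))"
  proof (rule sum.cong[OF refl], clarify)
    fix \<pi> :: "'n \<Rightarrow> 'n" assume \<pi>: "bij \<pi>"
    have "(W \<circ> \<pi>)(l := V ** W (\<pi> l)) = W(\<pi> l := V ** W (\<pi> l)) \<circ> \<pi>" for l
      using \<pi> by (auto simp: fun_eq_iff bij_is_inj inj_eq)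
    then have "site_op l V ** tensor_ops (W \<circ> \<pi>) = tensor_ops (W(\<pi> l := V ** W (\<pi> l)) \<circ> \<pi>)" for l
      by (simp add: site_op_mult)
    then have "(\<Sum>l\<in>UNIV. site_op l V ** tensor_ops (W \<circ> \<pi>)) =
        (\<Sum>l\<in>UNIV. tensor_ops (W(\<pi> l := V ** W (\<pi> l)) \<circ> \<pi>))" by simp
    also have "\<dots> = (\<Sum>k\<in>UNIV. tensor_ops (W(k := V ** W k) \<circ> \<pi>))"
      using \<pi> by (rule sum.reindex_bij_betw)
    finally show "(\<Sum>l\<in>UNIV. site_op l V ** tensor_ops (W \<circ> \<pi>)) =
        (\<Sum>k\<in>UNIV. tensor_ops (W(k := V ** W k) \<circ> \<pi>))" .
  qed
  also have "\<dots> = (\<Sum>k\<in>UNIV. sym_tensor (W(k := V ** W k)))"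
    unfolding sym_tensor_def by (rule sum.swap)
  finally show ?thesis .
qed

text \<open>Induction on the number of sites with \<open>W k \<noteq> 1\<close>: applying \<open>site_sum (W k)\<close> to the symmetrized tensor with
  \<open>W k\<close> replaced by \<open>1\<close> produces multiples of \<open>sym_tensor W\<close> and terms with fewer nontrivial sites.\<close>

lemma sym_tensor_in_commutant:
  fixes W :: "'n::finite \<Rightarrow> complex^'d::finite^'d"
  assumes one: "mat 1 \<in> C" and mult: "\<And>X Y. X \<in> C \<Longrightarrow> Y \<in> C \<Longrightarrow> X ** Y \<in> C"
    and site_sum: "\<And>X. X \<in> C \<Longrightarrow> (site_sum X :: complex^('n \<Rightarrow> 'd)^('n \<Rightarrow> 'd)) \<in> commutant S"
    and W: "\<And>k. W k \<in> C"
  shows "sym_tensor W \<in> commutant S"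
  using W
proof (induction "card {k. W k \<noteq> mat 1}" arbitrary: W rule: less_induct)
  case less
  show ?case
  proof (cases "\<exists>k. W k \<noteq> mat 1")
    case False
    then have "W \<circ> \<pi> = (\<lambda>_. mat 1)" for \<pi> :: "'n \<Rightarrow> 'n" by auto
    then show ?thesis
      unfolding sym_tensor_def by (intro commutant_sum) simp
  next
    case True
    then obtain k0 where k0: "W k0 \<noteq> mat 1" by blast
    define V where "V = W k0"
    define W' where "W' = W(k0 := mat 1)"
    \<comment> \<open>The sites left trivial once \<open>k0\<close> is cleared. Putting
      \<open>V\<close> at any of them gives \<open>W\<close> up to a transposition with
      \<open>k0\<close>, so each contributes the same symmetrized tensor; \<open>k0\<close> itself
      belongs to \<open>m\<close>, so their number can be divided out.\<close>
    define m where "m = {k. W' k = mat 1}"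
    have V: "V \<in> C" and W': "W' k \<in> C" for k
      using less.prems one by (simp_all add: V_def W'_def)
    have smaller: "card {k. U k \<noteq> mat 1} < card {k. W k \<noteq> mat 1}"
      if "\<And>k. W' k = mat 1 \<Longrightarrow> U k = mat 1" for U :: "'n \<Rightarrow> complex^'d^'d"
    proof (rule psubset_card_mono)
      show "{k. U k \<noteq> mat 1} \<subset> {k. W k \<noteq> mat 1}"
      proof
        have "U k0 = mat 1" by (rule that) (simp add: W'_def)
        then show "{k. U k \<noteq> mat 1} \<noteq> {k. W k \<noteq> mat 1}" using k0 by blast
        have "U k = mat 1" if "W k = mat 1" for k
          using that by (intro \<open>\<And>k. W' k = mat 1 \<Longrightarrow> U k = mat 1\<close>) (simp add: W'_def)
        then show "{k. U k \<noteq> mat 1} \<subseteq> {k. W k \<noteq> mat 1}" by blast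
      qed
    qed simp
    have replaced: "sym_tensor (W'(k := V ** W' k)) = sym_tensor W" if "k \<in> m" for k
    proof -
      have "W'(k := V ** W' k) = W \<circ> Transposition.transpose k k0"
        using that by (auto simp: m_def W'_def V_def fun_eq_iff Transposition.transpose_def split: if_splits)
      then show ?thesis by (simp add: sym_tensor_comp)
    qed
    have "site_sum V ** sym_tensor W' =
        (\<Sum>k\<in>m. sym_tensor (W'(k := V ** W' k))) + (\<Sum>k\<in>UNIV - m. sym_tensor (W'(k := V ** W' k)))"
      by (simp add: site_sum_sym_tensor sum.subset_diff[of m UNIV] add.commute)
    also have "(\<Sum>k\<in>m. sym_tensor (W'(k := V ** W' k))) = cscale (of_nat (card m)) (sym_tensor W)"
      by (simp add: replaced sum_const_cscale del: sum_constant)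
    finally have "cscale (of_nat (card m)) (sym_tensor W) =
        site_sum V ** sym_tensor W' - (\<Sum>k\<in>UNIV - m. sym_tensor (W'(k := V ** W' k)))"
      by (simp only: eq_diff_eq)
    moreover have "site_sum V ** sym_tensor W' \<in> commutant S"
      using V W' by (intro commutant_mult site_sum less.hyps smaller)
    \<comment> \<open>Outside \<open>m\<close>, \<open>V\<close> is multiplied onto a site that is
      already nontrivial, while \<open>k0\<close> stays trivial; the number of nontrivial sites has
      dropped.\<close>
    moreover have "sym_tensor (W'(k := V ** W' k)) \<in> commutant S" if "k \<in> UNIV - m" for k
      using that V W' by (intro less.hyps smaller) (auto simp: m_def intro: mult)
    ultimately have "cscale (of_nat (card m)) (sym_tensor W) \<in> commutant S"
      by (auto intro!: commutant_diff commutant_sum)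
    then have "cscale (1 / of_nat (card m)) (cscale (of_nat (card m)) (sym_tensor W)) \<in> commutant S"
      by (rule commutant_cscale)
    moreover have "card m \<noteq> 0" by (auto simp: card_eq_0_iff m_def W'_def)
    ultimately show ?thesis by simp
  qed
qed

section \<open>From gauge unitaries to site sums by differentiation\<close>

lemma bounded_bilinear_matrix_mult:
  "bounded_bilinear ((**) :: complex^'i^'i \<Rightarrow> complex^'i^'i \<Rightarrow> complex^'i^'i)"
  unfolding bilinear_conv_bounded_bilinear[symmetric] bilinear_def
  by (intro conjI allI linear_mult_left linear_mult_right)

lemma has_vector_derivative_matrixI:
  fixes X :: "real \<Rightarrow> complex^'i^'i"
  assumes "\<And>i j. ((\<lambda>t. X t $ i $ j) has_vector_derivative X' $ i $ j) (at a)"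
  shows "(X has_vector_derivative X') (at a)"
proof -
  have lin: "bounded_linear (\<lambda>c. cscale c U)" for U :: "complex^'i^'i"
    by (intro linear_conv_bounded_linear[THEN iffD1] linearI)
      (simp_all add: cmat.scale_left_distrib scaleR_conv_cscale scaleR_conv_of_real[where 'a=complex])
  have "((\<lambda>t. \<Sum>i\<in>UNIV. \<Sum>j\<in>UNIV. cscale (X t $ i $ j) (unit_matrix i j)) has_vector_derivative
      (\<Sum>i\<in>UNIV. \<Sum>j\<in>UNIV. cscale (X' $ i $ j) (unit_matrix i j))) (at a)"
    by (intro has_vector_derivative_sum bounded_linear.has_vector_derivative[OF lin] assms)
  then show ?thesis by (simp add: matrix_unit_expansion[symmetric])
qed

lemma tensor_power_has_vector_derivative:
  "((\<lambda>t. tensor_power (mat 1 + t *\<^sub>R X)) has_vector_derivative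
    (site_sum X :: complex^('n::finite \<Rightarrow> 'd::finite)^('n \<Rightarrow> 'd))) (at 0)"
proof (rule has_vector_derivative_matrixI)
  fix i j :: "'n \<Rightarrow> 'd"
  define f where "f k t = (mat 1 + t *\<^sub>R X) $ i k $ j k" for k t
  have "((\<lambda>t. \<Prod>k\<in>UNIV. f k t) has_derivative
      (\<lambda>y. \<Sum>k\<in>UNIV. y *\<^sub>R (X $ i k $ j k) * (\<Prod>l\<in>UNIV - {k}. f l 0))) (at 0)"
    unfolding f_def by (auto intro!: derivative_eq_intros)
  moreover have "site_sum X $ i $ j = (\<Sum>k\<in>UNIV. X $ i k $ j k * (\<Prod>l\<in>UNIV - {k}. f l 0))"
    by (simp add: site_sum_def site_op_def tensor_ops_upd f_def)
  ultimately show "((\<lambda>t. tensor_power (mat 1 + t *\<^sub>R X) $ i $ j) has_vector_derivative site_sum X $ i $ j) (at 0)"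
    by (simp add: has_vector_derivative_def tensor_power_def tensor_ops_component f_def scaleR_sum_right)
qed

lemma tensor_power_mult: "tensor_power X ** tensor_power Y = tensor_power (X ** Y)"
  by (simp add: tensor_power_def tensor_ops_mult)

lemma tensor_power_mat_1 [simp]: "tensor_power (mat 1) = mat 1"
  by (simp add: tensor_power_def)

lemma dagger_tensor_power: "dagger (tensor_power X) = tensor_power (dagger X)"
  by (simp add: tensor_power_def dagger_tensor_ops)

lemma gauge_group_iff: "V \<in> gauge_group \<A> \<longleftrightarrow> unitary V \<and> V \<in> commutant \<A>"
  by (auto simp: gauge_group_def commutant_def)

text \<open>With \<open>K t = 1 + i t H\<close>, the Cayley transform \<open>K t (K (-t))\<inverse>\<close> is a gauge unitary, so that
  \<open>K (-t)\<close> and \<open>K t\<close> can be exchanged around \<open>\<sigma>\<close> on tensor powers; the derivative at \<open>t = 0\<close> of this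
  polynomial identity is the claim.\<close>

lemma site_sum_commutes_self_adjoint:
  fixes \<sigma> :: "complex^('n::finite \<Rightarrow> 'd::finite)^('n \<Rightarrow> 'd)"
  assumes comm: "\<And>V. V \<in> gauge_group \<A> \<Longrightarrow> tensor_power V ** \<sigma> = \<sigma> ** tensor_power V"
    and H: "H \<in> commutant \<A>" and herm: "dagger H = H"
  shows "site_sum H ** \<sigma> = \<sigma> ** site_sum H"
proof -
  define X where "X = cscale \<i> H"
  define K where "K t = mat 1 + t *\<^sub>R X" for t
  let ?T = "tensor_power :: _ \<Rightarrow> complex^('n \<Rightarrow> 'd)^('n \<Rightarrow> 'd)"
  have dagger_K: "dagger (K t) = K (- t)" for t
    by (simp add: K_def X_def dagger_add scaleR_conv_cscale dagger_cscale herm cmat.scale_minus_left)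
  have K_comm: "K s ** K t = K t ** K s" for s t
    by (simp add: K_def scaleR_conv_cscale mult_add_left mult_add_right mult.commute add_ac
        cmat.scale_right_distrib)
  have K_in: "K t \<in> commutant \<A>" for t
    unfolding K_def X_def scaleR_conv_cscale by (intro commutant_add commutant_cscale H) simp
  \<comment> \<open>\<open>K t\<close> is invertible because \<open>H\<close> has real expectation
    values: the term with \<open>\<i>\<close> is purely imaginary, so the real part of the form of
    \<open>K t\<close> at \<open>x\<close> is \<open>x \<bullet> x\<close>.\<close>
  have inj: "x = 0" if "K t *v x = 0" for t x
  proof -
    have "cinner x (H *v x) = cnj (cinner x (H *v x))"
      using cinner_dagger[of x H x] herm by (metis cinner_commute)
    then have "Im (cinner x (H *v x)) = 0" by (simp add: complex_eq_iff)
    moreover have "(t *\<^sub>R X) *v x = (of_real t * \<i>) *s (H *v x)"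
      by (simp add: X_def scaleR_conv_cscale vec_eq_iff matrix_vector_mult_def sum_distrib_left mult.assoc)
    then have "cinner x (K t *v x) = cinner x x + of_real t * \<i> * cinner x (H *v x)"
      by (simp add: K_def matrix_vector_mult_add_rdistrib cinner_add_right cinner_scale_right)
    ultimately have "x \<bullet> x = Re (cinner x (K t *v x))"
      by (simp add: cinner_real_inner)
    then show ?thesis using that by (simp add: cinner_def)
  qed
  have exchange: "?T (K (- t)) ** \<sigma> ** ?T (K t) = ?T (K t) ** \<sigma> ** ?T (K (- t))" for t
  proof -
    obtain B where B: "B ** K (- t) = mat 1"
      using inj matrix_left_invertible_ker[of "K (- t)"] by blast
    then have B': "K (- t) ** B = mat 1" by (simp add: matrix_left_right_inverse)
    have BK: "B ** K t = K t ** B"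
    proof -
      have "B ** K t ** (K (- t) ** B) = B ** (K t ** K (- t)) ** B" by (simp add: matrix_mul_assoc)
      also have "\<dots> = (B ** K (- t)) ** K t ** B" by (simp add: K_comm[of t] matrix_mul_assoc)
      finally show ?thesis by (simp add: B B')
    qed
    define V where "V = K t ** B"
    have dV: "dagger V = dagger B ** K (- t)" by (simp add: V_def dagger_mult dagger_K)
    have dB: "dagger B ** K t = mat 1" "K t ** dagger B = mat 1"
    proof -
      have "dagger (K (- t) ** B) = mat 1" "dagger (B ** K (- t)) = mat 1" by (simp_all add: B B')
      then show "dagger B ** K t = mat 1" "K t ** dagger B = mat 1"
        by (simp_all add: dagger_mult dagger_K)
    qed
    have "dagger V ** V = dagger B ** (K (- t) ** K t) ** B"
      by (simp add: dV) (simp add: V_def matrix_mul_assoc)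
    also have "\<dots> = (dagger B ** K t) ** (K (- t) ** B)"
      by (simp add: K_comm[of "- t"] matrix_mul_assoc)
    finally have "dagger V ** V = mat 1" by (simp add: dB B')
    then have "unitary V" by (simp add: unitary_def matrix_left_right_inverse)
    moreover have "B \<in> commutant \<A>"
    proof (rule commutantI)
      fix A assume "A \<in> \<A>"
      then have AK: "A ** K (- t) = K (- t) ** A" using K_in by (blast dest: commutantD)
      have "B ** (A ** K (- t)) ** B = B ** A ** (K (- t) ** B)" by (simp add: matrix_mul_assoc)
      moreover have "B ** (K (- t) ** A) ** B = (B ** K (- t)) ** A ** B" by (simp add: matrix_mul_assoc)
      ultimately show "A ** B = B ** A" by (simp add: AK B B')
    qed
    ultimately have "V \<in> gauge_group \<A>"
      using commutant_mult[OF K_in[of t]] by (simp add: gauge_group_iff V_def)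
    then have V: "?T (K t) ** ?T B ** \<sigma> = \<sigma> ** (?T (K t) ** ?T B)"
      using comm[of V] by (simp add: V_def tensor_power_mult)
    \<comment> \<open>\<open>K (- t) ** V\<close> and \<open>V ** K (- t)\<close> both equal
      \<open>K t\<close>, so multiplying the commutation relation of \<open>V\<close> by the tensor
      power of \<open>K (- t)\<close> on both sides clears the inverse.\<close>
    have "?T (K t) ** \<sigma> ** ?T (K (- t)) = ?T (K (- t)) ** (?T (K t) ** ?T B ** \<sigma>) ** ?T (K (- t))"
    proof -
      have "K (- t) ** (K t ** B) = K t"
        by (simp add: BK[symmetric] matrix_mul_assoc B')
      then show ?thesis by (simp add: matrix_mul_assoc[symmetric]) (simp add: matrix_mul_assoc tensor_power_mult)
    qed
    also have "\<dots> = ?T (K (- t)) ** \<sigma> ** ?T (K t ** (B ** K (- t)))"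
      by (simp add: V matrix_mul_assoc tensor_power_mult[symmetric])
    finally show ?thesis by (simp add: B)
  qed
  have deriv: "((\<lambda>t. ?T (K t)) has_vector_derivative site_sum X) (at 0)"
    unfolding K_def by (rule tensor_power_has_vector_derivative)
  have site_sum_minus: "site_sum (- X) = - (site_sum X :: complex^('n \<Rightarrow> 'd)^('n \<Rightarrow> 'd))"
    by (simp add: site_sum_def site_op_def vec_eq_iff tensor_ops_upd sum_negf)
  have deriv': "((\<lambda>t. ?T (K (- t))) has_vector_derivative - site_sum X) (at 0)"
    using tensor_power_has_vector_derivative[where 'n = 'n, of "- X"] by (simp add: K_def site_sum_minus)
  note mult = bounded_bilinear.has_vector_derivative[OF bounded_bilinear_matrix_mult]
  have const: "((\<lambda>t. \<sigma>) has_vector_derivative 0) (at 0)" by simp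
  have "((\<lambda>t. ?T (K (- t)) ** \<sigma> ** ?T (K t)) has_vector_derivative
      \<sigma> ** site_sum X - site_sum X ** \<sigma>) (at 0)"
    using mult[OF mult[OF deriv' const] deriv] by (simp add: K_def mult_minus_left)
  moreover have "((\<lambda>t. ?T (K t) ** \<sigma> ** ?T (K (- t))) has_vector_derivative
      site_sum X ** \<sigma> - \<sigma> ** site_sum X) (at 0)"
    using mult[OF mult[OF deriv const] deriv'] by (simp add: K_def mult_minus_right)
  \<comment> \<open>Exchanging \<open>t\<close> and \<open>- t\<close> changes the sign of the
    derivative, so the commutator equals its own negative.\<close>
  ultimately have "\<sigma> ** site_sum X - site_sum X ** \<sigma> = site_sum X ** \<sigma> - \<sigma> ** site_sum X"
    unfolding exchange by (rule vector_derivative_unique_at)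
  then have "site_sum X ** \<sigma> = \<sigma> ** site_sum X"
    by (simp add: algebra_simps vec_eq_iff)
  moreover have "site_sum X = cscale \<i> (site_sum H :: complex^('n \<Rightarrow> 'd)^('n \<Rightarrow> 'd))"
    by (simp add: X_def site_sum_def site_op_def tensor_ops_upd_cscale cmat.scale_sum_right)
  ultimately show ?thesis by simp
qed

text \<open>Splitting into self-adjoint parts: the commutant is closed under adjoints because
  \<open>\<A>\<close> is, so \<open>W = H1 + cscale \<i> H2\<close> with both parts in it, and
  \<open>site_sum\<close> is complex linear.\<close>

lemma site_sum_commutes:
  fixes \<sigma> :: "complex^('n::finite \<Rightarrow> 'd::finite)^('n \<Rightarrow> 'd)"
  assumes dagger: "\<And>A. A \<in> \<A> \<Longrightarrow> dagger A \<in> \<A>"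
    and comm: "\<And>V. V \<in> gauge_group \<A> \<Longrightarrow> tensor_power V ** \<sigma> = \<sigma> ** tensor_power V"
    and W: "W \<in> commutant \<A>"
  shows "site_sum W ** \<sigma> = \<sigma> ** site_sum W"
proof -
  have W': "dagger W \<in> commutant \<A>"
    using star_algebra_commutant[OF dagger] W
    by (simp add: star_algebra_imp_subspace star_subspace_dagger)
  define H1 where "H1 = cscale (1/2) (W + dagger W)"
  define H2 where "H2 = cscale (- \<i>/2) (W - dagger W)"
  have "H1 \<in> commutant \<A>" "H2 \<in> commutant \<A>"
    unfolding H1_def H2_def by (intro commutant_add commutant_diff commutant_cscale W W')+
  moreover have "dagger H1 = H1" "dagger H2 = H2"
    by (simp_all add: H1_def H2_def vec_eq_iff algebra_simps)
  ultimately have H: "site_sum H1 ** \<sigma> = \<sigma> ** site_sum H1" "site_sum H2 ** \<sigma> = \<sigma> ** site_sum H2"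
    using site_sum_commutes_self_adjoint[OF comm] by blast+
  have "W = H1 + cscale \<i> H2"
    by (simp add: H1_def H2_def vec_eq_iff algebra_simps)
  then have "site_sum W = site_sum H1 + cscale \<i> (site_sum H2 :: complex^('n \<Rightarrow> 'd)^('n \<Rightarrow> 'd))"
    by (simp add: site_sum_def site_op_def tensor_ops_upd_add tensor_ops_upd_cscale sum.distrib
        cmat.scale_sum_right)
  then show ?thesis by (simp add: mult_add_left mult_add_right H)
qed

section \<open>Averages of pure product states\<close>

lemma continuous_on_matrixI:
  fixes f :: "'a::topological_space \<Rightarrow> complex^'i^'j"
  assumes "\<And>i j. continuous_on S (\<lambda>x. f x $ i $ j)"
  shows "continuous_on S f"
proof -
  have "continuous_on S (\<lambda>x. \<chi> i j. f x $ i $ j)"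
    by (intro continuous_on_vec_lambda assms)
  then show ?thesis by simp
qed

lemma continuous_on_tensor_power: "continuous_on S tensor_power"
  by (rule continuous_on_matrixI)
    (auto simp: tensor_power_def tensor_ops_component intro!: continuous_intros)

text \<open>Pure states lie in the continuous image of the compact unit sphere. The bound supplies
  the dominating function for averages of tensor powers.\<close>

lemma bounded_tensor_power_pure_states:
  "bounded (tensor_power ` pure_states :: (complex^('n::finite \<Rightarrow> 'd::finite)^('n \<Rightarrow> 'd)) set)"
proof -
  let ?f = "\<lambda>\<psi> :: complex^'d. (\<chi> i j. \<psi> $ i * cnj (\<psi> $ j)) :: complex^'d^'d"
  have "pure_states \<subseteq> ?f ` sphere 0 1"
  proof
    fix \<rho> :: "complex^'d^'d" assume "\<rho> \<in> pure_states"
    then obtain \<psi> where \<rho>: "\<rho> = ?f \<psi>" and "cinner \<psi> \<psi> = 1" by (auto simp: pure_states_def)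
    then have "\<psi> \<bullet> \<psi> = 1" using cinner_real_inner[of \<psi> \<psi>] by simp
    then have "\<psi> \<in> sphere 0 1" by (simp add: norm_eq_sqrt_inner)
    then show "\<rho> \<in> ?f ` sphere 0 1" by (simp add: \<rho>)
  qed
  moreover have "compact (?f ` sphere 0 1)"
    by (intro compact_continuous_image continuous_on_matrixI)
      (auto intro!: continuous_intros)
  then have "compact (tensor_power ` ?f ` sphere 0 1 :: (complex^('n \<Rightarrow> 'd)^('n \<Rightarrow> 'd)) set)"
    by (rule compact_continuous_image[OF continuous_on_tensor_power])
  ultimately show ?thesis
    by (meson bounded_subset compact_imp_bounded image_mono)
qed

text \<open>For a pure state the entry at \<open>i\<close>, \<open>j\<close> splits into a function
  of \<open>i\<close> times a function of \<open>j\<close>, each a product over all sites; permuting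
  the sites in \<open>i\<close> alone therefore changes nothing.\<close>

lemma sym_proj_tensor_power_pure:
  fixes \<rho> :: "complex^'d::finite^'d"
  assumes "\<rho> \<in> pure_states"
  shows "sym_proj ** tensor_power \<rho> = (tensor_power \<rho> :: complex^('n::finite \<Rightarrow> 'd)^('n \<Rightarrow> 'd))"
    and "tensor_power \<rho> ** sym_proj = (tensor_power \<rho> :: complex^('n::finite \<Rightarrow> 'd)^('n \<Rightarrow> 'd))"
proof -
  let ?T = "tensor_power \<rho> :: complex^('n \<Rightarrow> 'd)^('n \<Rightarrow> 'd)"
  obtain \<psi> where \<rho>: "\<rho> = (\<chi> i j. \<psi> $ i * cnj (\<psi> $ j))"
    using assms by (auto simp: pure_states_def)
  have T: "?T $ i $ j = (\<Prod>k\<in>UNIV. \<psi> $ i k) * cnj (\<Prod>k\<in>UNIV. \<psi> $ j k)" for i j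
    by (simp add: \<rho> tensor_power_def tensor_ops_component prod.distrib)
  show left: "sym_proj ** ?T = ?T"
  proof (rule sym_proj_mult_eqI)
    fix \<tau> :: "'n \<Rightarrow> 'n" assume \<tau>: "bij \<tau>"
    have eq: "i = m \<circ> \<tau> \<longleftrightarrow> m = i \<circ> inv \<tau>" for i m :: "'n \<Rightarrow> 'd"
      using \<tau> by (auto simp: fun_eq_iff bij_is_surj surj_f_inv_f bij_is_inj)
    have "(perm_op \<tau> ** ?T) $ i $ j = ?T $ (i \<circ> inv \<tau>) $ j" for i j
      by (simp add: matrix_mult_component perm_op_def eq if_distrib[of "\<lambda>x. x * _"] cong: if_cong)
    moreover have "(\<Prod>k\<in>UNIV. \<psi> $ i (inv \<tau> k)) = (\<Prod>k\<in>UNIV. \<psi> $ i k)" for i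
      using bij_imp_bij_inv[OF \<tau>] by (rule prod.reindex_bij_betw)
    ultimately show "perm_op \<tau> ** ?T = ?T" by (simp add: vec_eq_iff T)
  qed
  have "dagger \<rho> = \<rho>" by (simp add: \<rho> vec_eq_iff)
  then have "dagger ?T = ?T" by (simp add: dagger_tensor_power)
  then show "?T ** sym_proj = ?T"
    using arg_cong[OF left, of dagger] by (simp add: dagger_mult dagger_sym_proj)
qed

section \<open>Unitary conjugation and invariant averages\<close>

lemma conj_by_density_operators:
  assumes "unitary V" "\<rho> \<in> density_operators"
  shows "conj_by V \<rho> \<in> density_operators"
proof -
  have "positive_op (dagger (dagger V) ** \<rho> ** dagger V)"
    using assms(2) by (intro positive_op_congruence) (simp add: density_operators_def)
  moreover have "trace (V ** \<rho> ** dagger V) = trace \<rho>"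
    using assms by (simp add: trace_cyclic[of V] unitary_def)
  ultimately show ?thesis
    using assms(2) by (simp add: density_operators_def conj_by_def)
qed

lemma continuous_on_conj_by: "continuous_on S (conj_by V)"
  unfolding conj_by_def
  by (intro linear_continuous_on linear_conv_bounded_linear[THEN iffD1]
      linear_compose[OF linear_mult_left linear_mult_right, unfolded o_def])

lemma measurable_conj_by:
  assumes "reference_measure D" "unitary V"
  shows "conj_by V \<in> measurable D D"
proof -
  have sets: "sets D = sets (restrict_space borel density_operators)"
    using assms by (simp add: reference_measure_def)
  have "conj_by V \<in> borel_measurable borel"
    by (intro borel_measurable_continuous_onI continuous_on_conj_by)
  then have "conj_by V \<in> measurable (restrict_space borel density_operators) (restrict_space borel density_operators)"
    using assms(2) by (intro measurable_restrict_space2 measurable_restrict_space1)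
      (auto simp: space_restrict_space conj_by_density_operators)
  then show ?thesis by (simp add: measurable_cong_sets[OF sets sets])
qed

lemma gauge_group_imp_unitary: "V \<in> gauge_group \<A> \<Longrightarrow> unitary V"
  by (simp add: gauge_group_def)

text \<open>Purity puts the average between two copies of \<open>sym_proj\<close>. The change of
  variables \<open>conj_by V\<close>, which preserves both \<open>D\<close> and \<open>f\<close>,
  makes it commute with collective gauge unitaries; differentiation extends this to site sums and
  induction to symmetrized products, as \<open>symmetric_duality\<close> requires.\<close>

lemma average_in_compression:
  fixes D :: "(complex^'d::finite^'d) measure" and f :: "complex^'d^'d \<Rightarrow> real"
  assumes \<A>: "von_neumann_algebra \<A>" and D: "reference_measure D"
    and f: "integrable D f"
    and inv: "\<And>V \<rho>. V \<in> gauge_group \<A> \<Longrightarrow> \<rho> \<in> density_operators \<Longrightarrow> f (conj_by V \<rho>) = f \<rho>"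
    and pure: "\<And>\<rho>. f \<rho> \<noteq> 0 \<Longrightarrow> \<rho> \<in> pure_states"
  defines "g \<equiv> \<lambda>\<rho>. f \<rho> *\<^sub>R (tensor_power \<rho> :: complex^('n::finite \<Rightarrow> 'd)^('n \<Rightarrow> 'd))"
  shows "integrable D g" and "\<exists>Y \<in> symmetric_algebra \<A>. integral\<^sup>L D g = sym_proj ** Y"
proof -
  let ?T = "tensor_power :: _ \<Rightarrow> complex^('n \<Rightarrow> 'd)^('n \<Rightarrow> 'd)"
  have space: "space D = density_operators"
    and sets: "sets D = sets (restrict_space borel density_operators)"
    using D by (simp_all add: reference_measure_def)
  have meas: "?T \<in> borel_measurable D"
    unfolding measurable_cong_sets[OF sets refl]
    by (intro measurable_restrict_space1 borel_measurable_continuous_onI continuous_on_tensor_power)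
  obtain c where c: "\<And>\<rho>. \<rho> \<in> pure_states \<Longrightarrow> norm (?T \<rho>) \<le> c"
    using bounded_tensor_power_pure_states by (auto simp: bounded_iff)
  show int: "integrable D g"
  proof (rule Bochner_Integration.integrable_bound)
    show "integrable D (\<lambda>\<rho>. c * f \<rho>)" using f by simp
    show "g \<in> borel_measurable D"
      unfolding g_def using meas f by (intro borel_measurable_scaleR) auto
    have "norm (g \<rho>) \<le> norm (c * f \<rho>)" for \<rho>
    proof (cases "f \<rho> = 0")
      case False
      have "norm (?T \<rho>) \<le> \<bar>c\<bar>" using c[OF pure[OF False]] by simp
      from mult_right_mono[OF this, of "\<bar>f \<rho>\<bar>"] show ?thesis
        by (simp add: g_def abs_mult mult.commute)
    qed (simp add: g_def)
    then show "AE \<rho> in D. norm (g \<rho>) \<le> norm (c * f \<rho>)" by simp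
  qed
  let ?\<sigma> = "integral\<^sup>L D g"
  have lin: "h ?\<sigma> = integral\<^sup>L D (\<lambda>\<rho>. h (g \<rho>))" if "linear h" for h :: "_ \<Rightarrow> complex^('n \<Rightarrow> 'd)^('n \<Rightarrow> 'd)"
    using that int by (simp add: integral_bounded_linear linear_conv_bounded_linear)
  have support: "sym_proj ** g \<rho> = g \<rho>" "g \<rho> ** sym_proj = g \<rho>" for \<rho>
    using sym_proj_tensor_power_pure[OF pure, of \<rho>]
    by (cases "f \<rho> = 0"; simp add: g_def scaleR_conv_cscale)+
  have left: "sym_proj ** ?\<sigma> = ?\<sigma>" and right: "?\<sigma> ** sym_proj = ?\<sigma>"
    using lin[OF linear_mult_left] lin[OF linear_mult_right] by (simp_all add: support)
  have comm: "?T V ** ?\<sigma> = ?\<sigma> ** ?T V" if V: "V \<in> gauge_group \<A>" for V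
  proof -
    note unitary = gauge_group_imp_unitary[OF V]
    have "?T V ** ?\<sigma> ** ?T (dagger V) = integral\<^sup>L D (\<lambda>\<rho>. ?T V ** g \<rho> ** ?T (dagger V))"
      by (rule lin[OF linear_compose[OF linear_mult_left linear_mult_right, unfolded o_def]])
    also have "\<dots> = integral\<^sup>L D (\<lambda>\<rho>. g (conj_by V \<rho>))"
      using inv[OF V]
      by (intro Bochner_Integration.integral_cong)
        (simp_all add: g_def space scaleR_conv_cscale conj_by_def tensor_power_mult)
    also have "\<dots> = integral\<^sup>L (distr D D (conj_by V)) g"
      using int by (intro integral_distr[symmetric] measurable_conj_by[OF D unitary]) auto
    also have "distr D D (conj_by V) = D" using D unitary by (simp add: reference_measure_def)
    finally have "?T V ** ?\<sigma> ** ?T (dagger V) ** ?T V = ?\<sigma> ** ?T V" by simp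
    moreover have "?T (dagger V) ** ?T V = mat 1"
      using unitary by (simp add: tensor_power_mult unitary_def)
    ultimately show ?thesis by (simp add: matrix_mul_assoc[symmetric])
  qed
  have C: "star_algebra (commutant \<A>)"
    using \<A> by (intro star_algebra_commutant) (simp add: von_neumann_algebra_def)
  show "\<exists>Y \<in> symmetric_algebra \<A>. ?\<sigma> = sym_proj ** Y"
  proof (rule symmetric_duality[OF \<A> left right])
    fix W :: "'n \<Rightarrow> complex^'d^'d" assume W: "\<And>k. W k \<in> commutant \<A>"
    have "site_sum X \<in> commutant {?\<sigma>}" if "X \<in> commutant \<A>" for X
      using site_sum_commutes[OF _ comm that] \<A> by (auto simp: von_neumann_algebra_def intro!: commutantI)
    then have "sym_tensor W \<in> commutant {?\<sigma>}"
      using W by (intro sym_tensor_in_commutant[where C = "commutant \<A>"]) (auto intro: commutant_mult)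
    then show "sym_tensor W ** ?\<sigma> = ?\<sigma> ** sym_tensor W" by (simp add: commutant_def)
  qed
qed

theorem theorem11:
  fixes \<A> :: "(complex^'d^'d) set"
    and D :: "(complex^'d^'d) measure"
    and p :: "complex^'d^'d \<Rightarrow> real"
    and s :: "complex^'d^'d \<Rightarrow> real^'l"
    and E :: "complex^('n::finite \<Rightarrow> 'd)^('n \<Rightarrow> 'd) \<Rightarrow> complex^('n \<Rightarrow> 'd)^('n \<Rightarrow> 'd)"
    and N :: "'w measure"
    and M :: "'w set \<Rightarrow> complex^('n \<Rightarrow> 'd)^('n \<Rightarrow> 'd)"
  assumes "von_neumann_algebra \<A>"
    and "reference_measure D"
    and "prior_density D p"
    and "parameters D p s"
    and "quantum_channel E"
    and "prior_symmetry (gauge_group \<A>) p"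
    and "parameter_symmetry (gauge_group \<A>) p s"
    and "E = id"
    and "prior_supp p \<subseteq> pure_states"
    and "povm N M"
  shows "\<exists>M' :: 'w set \<Rightarrow> complex^('n \<Rightarrow> 'd)^('n \<Rightarrow> 'd).
           povm N M' \<and> (\<forall>B\<in>sets N. M' B \<in> algebra_tensor_power \<A>) \<and>
           (\<forall>B\<in>sets N. \<forall>\<Delta>. is_interval \<Delta> \<longrightarrow> event_prob D p s \<Delta> \<noteq> 0 \<longrightarrow>
              cond_outcome_prob D p s E M B \<Delta> = cond_outcome_prob D p s E M' B \<Delta>)"
proof -
  let ?B = "symmetric_algebra \<A> :: (complex^('n \<Rightarrow> 'd)^('n \<Rightarrow> 'd)) set"
  let ?P = "sym_proj :: complex^('n \<Rightarrow> 'd)^('n \<Rightarrow> 'd)"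
  have B: "star_algebra ?B" "mat 1 \<in> ?B"
    using assms(1)
    by (simp_all add: von_neumann_algebra_iff star_algebra_symmetric_algebra mat_1_in_symmetric_algebra)
  have "?P \<in> commutant ?B"
    by (rule sym_proj_in_commutant) (simp add: symmetric_algebra_def)
  then obtain L where L: "linear L" "\<And>X. L X \<in> ?B" "\<And>X. positive_op X \<Longrightarrow> positive_op (L X)"
    "L (mat 1) = mat 1" "\<And>X Y. Y \<in> ?B \<Longrightarrow> trace (L X ** (?P ** Y)) = trace (X ** (?P ** Y))"
    using positive_lift[OF B sym_proj_idem dagger_sym_proj] by metis
  have "povm N (\<lambda>B. L (M B))"
    unfolding povm_def
  proof (intro conjI ballI allI impI)
    show "positive_op (L (M B))" if "B \<in> sets N" for B
      using assms(10) that L by (simp add: povm_def)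
    show "(\<lambda>i. L (M (B i))) sums L (M (\<Union>i. B i))"
      if "range B \<subseteq> sets N" "disjoint_family B" for B :: "nat \<Rightarrow> 'w set"
    proof -
      \<comment> \<open>In finite dimension the linear map \<open>L\<close> is continuous, so it
        preserves the convergent sums of countable additivity.\<close>
      have "bounded_linear L" using L(1) by (simp add: linear_conv_bounded_linear)
      moreover have "(\<lambda>i. M (B i)) sums M (\<Union>i. B i)"
        using assms(10) that unfolding povm_def by blast
      ultimately show ?thesis by (rule bounded_linear.sums)
    qed
    show "L (M (space N)) = mat 1" using assms(10) L by (simp add: povm_def)
  qed
  moreover have "cond_outcome_prob D p s E M B \<Delta> = cond_outcome_prob D p s E (\<lambda>B. L (M B)) B \<Delta>"
    if prob: "event_prob D p s \<Delta> \<noteq> 0" for B \<Delta>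
  proof -
    let ?E = "parameter_event p s \<Delta>"
    define f where "f \<rho> = indicator ?E \<rho> * p \<rho>" for \<rho>
    define g where "g \<rho> = f \<rho> *\<^sub>R (tensor_power \<rho> :: complex^('n \<Rightarrow> 'd)^('n \<Rightarrow> 'd))" for \<rho>
    \<comment> \<open>The integral of a nonintegrable function is 0 by convention, so nonzero
      probability of the event yields integrability.\<close>
    have f_int: "integrable D f"
    proof (rule ccontr)
      assume "\<not> integrable D f"
      then have "integral\<^sup>L D f = 0" by (rule not_integrable_integral_eq)
      then show False
        using prob by (simp add: event_prob_def set_lebesgue_integral_def f_def[abs_def])
    qed
    have f_inv: "f (conj_by V \<rho>) = f \<rho>" if "V \<in> gauge_group \<A>" "\<rho> \<in> density_operators" for V \<rho>
    proof -
      have p_inv: "p (conj_by V \<rho>) = p \<rho>" using assms(6) that by (simp add: prior_symmetry_def)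
      have "conj_by V \<rho> \<in> density_operators"
        using that by (intro conj_by_density_operators gauge_group_imp_unitary)
      moreover have "s (conj_by V \<rho>) = s \<rho>" if "\<rho> \<in> prior_supp p"
        using assms(7) \<open>V \<in> gauge_group \<A>\<close> that by (simp add: parameter_symmetry_def)
      ultimately have "conj_by V \<rho> \<in> ?E \<longleftrightarrow> \<rho> \<in> ?E"
        using that p_inv by (auto simp: parameter_event_def prior_supp_def)
      then show ?thesis by (simp add: f_def p_inv indicator_def)
    qed
    have f_pure: "\<rho> \<in> pure_states" if "f \<rho> \<noteq> 0" for \<rho>
      using that assms(9) by (auto simp: f_def parameter_event_def split: split_indicator_asm)
    note average = average_in_compression[OF assms(1,2) f_int f_inv f_pure, where 'n = 'n, folded g_def]
    \<comment> \<open>A measurement enters the conditional probability only through its trace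
      against one averaged operator. That operator has the form \<open>?P ** Y\<close> with
      \<open>Y\<close> in \<open>?B\<close>, where \<open>L\<close> leaves the trace
      unchanged.\<close>
    have cond: "cond_outcome_prob D p s E M' B \<Delta> =
        1 / complex_of_real (event_prob D p s \<Delta>) * trace (M' B ** integral\<^sup>L D g)" for M'
    proof -
      have "bounded_linear (\<lambda>X. trace (M' B ** X))"
        using linear_compose[OF linear_mult_left linear_trace]
        by (simp add: o_def linear_conv_bounded_linear)
      from integral_bounded_linear[OF this average(1)]
      have "trace (M' B ** integral\<^sup>L D g) = integral\<^sup>L D (\<lambda>\<rho>. trace (M' B ** g \<rho>))"
        by (rule sym)
      moreover have "trace (M' B ** g \<rho>) =
          indicator ?E \<rho> *\<^sub>R (complex_of_real (p \<rho>) * outcome_prob E M' B \<rho>)" for \<rho>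
        using assms(8)
        by (simp add: g_def f_def scaleR_conv_cscale trace_cscale outcome_prob_def
            scaleR_conv_of_real[where 'a=complex])
      ultimately show ?thesis
        by (simp add: cond_outcome_prob_def set_lebesgue_integral_def)
    qed
    obtain Y where "Y \<in> ?B" "integral\<^sup>L D g = ?P ** Y" using average(2) by blast
    then show ?thesis unfolding cond by (simp add: L(5))
  qed
  ultimately show ?thesis
    using L(2) by (intro exI[of _ "\<lambda>B. L (M B)"]) (auto simp: symmetric_algebra_def)
qed

end
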